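(* Let $M$ be an $F$-structure manifold of degree $K$. The distribution $D_l$ is integrable if and only if $$N_l(lX,lY)=0\quad\text{for all vector fields }X,Y\text{ on }M,$$ or, equivalently, if and only if $m[lX,lY]=0$ for all vector fields $X,Y$ on $M$.
   Context: An $F$-structure manifold of degree $K$ is a smooth $n$-dimensional manifold $M$ with a nonzero smooth $(1,1)$-tensor field $F$ of constant rank $r$ satisfying $\alpha F^{K+1}+\beta F^{K}+F=0$, where $K\ge 3$ is an integer and $\alpha,\beta$ are real or complex numbers (polynomials in $F$ with complex coefficients are regarded as endomorphisms of the complexified tangent bundle). Put $l=-(\alpha F^{K}+\beta F^{K-1})$ and $m=I+\alpha F^{K}+\beta F^{K-1}$; $D_l=\mathrm{Im}\,l$ and $D_m=\mathrm{Im}\,m$ are complementary distributions of dimensions $r$ and $n-r$. For a $(1,1)$-tensor field $T$, the Nijenhuis tensor is $N_T(X,Y)=[TX,TY]-T[TX,Y]-T[X,TY]+T^2[X,Y]$. A distribution $D$ is integrable if through each point of $M$ there is an integral manifold of $D$ (equivalently, by Frobenius, $D$ is involutive). *)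

theory Defs
  imports "HOL-Analysis.Analysis"
begin

section \<open>Smooth maps and smooth manifolds\<close>

text \<open>The sets S below are always open. The value of f outside S is irrelevant.\<close>

primrec Ck_on :: "nat \<Rightarrow> ('v::euclidean_space) set \<Rightarrow> ('v \<Rightarrow> 'w::real_normed_vector) \<Rightarrow> bool" where
  "Ck_on 0 S f \<longleftrightarrow> continuous_on S f"
| "Ck_on (Suc k) S f \<longleftrightarrow>
     (\<forall>x\<in>S. f differentiable (at x)) \<and> (\<forall>v. Ck_on k S (\<lambda>x. frechet_derivative f (at x) v))"

definition smooth_on :: "('v::euclidean_space) set \<Rightarrow> ('v \<Rightarrow> 'w::real_normed_vector) \<Rightarrow> bool" where
  "smooth_on S f \<longleftrightarrow> (\<forall>k. Ck_on k S f)"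

text \<open>A chart is a pair of a domain and a coordinate map. The coordinate map is only meaningful
  on the domain.\<close>

type_synonym ('a, 'n) chart = "'a set \<times> ('a \<Rightarrow> real ^ 'n)"

definition chart_inv :: "('a, 'n) chart \<Rightarrow> real ^ 'n \<Rightarrow> 'a" where
  "chart_inv c = inv_into (fst c) (snd c)"

text \<open>Coordinate expression, from c to d, of the identity map. The charts may belong to
  two manifolds of different dimensions whose points lie in the same type; this is how the inclusion
  of a submanifold is expressed.\<close>

definition transition :: "('a, 'n) chart \<Rightarrow> ('a, 'm) chart \<Rightarrow> real ^ 'n \<Rightarrow> real ^ 'm" where
  "transition c d = snd d \<circ> chart_inv c"

definition jacobian ::
    "('a, 'n::finite) chart \<Rightarrow> ('a, 'm::finite) chart \<Rightarrow> 'a \<Rightarrow> real ^ 'n ^ 'm" where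
  "jacobian c d p = matrix (frechet_derivative (transition c d) (at (snd c p)))"

text \<open>The atlas is an arbitrary smooth atlas, not necessarily a maximal one.\<close>

definition smooth_manifold :: "'a topology \<Rightarrow> ('a, 'n::finite) chart set \<Rightarrow> bool" where
  "smooth_manifold M A \<longleftrightarrow>
     Hausdorff_space M \<and> second_countable M \<and>
     (\<forall>c\<in>A. openin M (fst c) \<and> open (snd c ` fst c) \<and>
        homeomorphic_map (subtopology M (fst c)) (top_of_set (snd c ` fst c)) (snd c)) \<and>
     (\<Union>c\<in>A. fst c) = topspace M \<and>
     (\<forall>c\<in>A. \<forall>d\<in>A. smooth_on (snd c ` (fst c \<inter> fst d)) (transition c d))"

text \<open>An injectively immersed submanifold: N carries its own topology and its own atlas B, and
  the inclusion of N into M is an immersion.\<close>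

definition immersed_submanifold ::
    "'a topology \<Rightarrow> ('a, 'r::finite) chart set \<Rightarrow> 'a topology \<Rightarrow> ('a, 'n::finite) chart set \<Rightarrow> bool" where
  "immersed_submanifold N B M A \<longleftrightarrow>
     smooth_manifold N B \<and> topspace N \<subseteq> topspace M \<and> continuous_map N M (\<lambda>q. q) \<and>
     (\<forall>d\<in>B. \<forall>c\<in>A.
        smooth_on (snd d ` (fst d \<inter> fst c)) (transition d c) \<and>
        (\<forall>q \<in> fst d \<inter> fst c. inj ((*v) (jacobian d c q))))"

section \<open>Tangent vectors, vector fields and tensor fields\<close>

text \<open>Everything is done over a scalar field 'k which is a finite-dimensional real normed field,
  that is, the reals or the complex numbers. For 'k = real the space below is the tangent space
  at p; for 'k = complex it is the complexified tangent space. A tangent vector is the family of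
  its component vectors in the charts at p, subject to the usual transformation law; the
  components with respect to anything else than a chart at p are set to 0.\<close>

type_synonym ('a, 'n, 'k) tvec = "('a, 'n) chart \<Rightarrow> 'k ^ 'n"

definition tangent_space ::
    "('a, 'n::finite) chart set \<Rightarrow> 'a
      \<Rightarrow> ('a, 'n, 'k::{real_normed_field,euclidean_space}) tvec set" where
  "tangent_space A p =
     {v. (\<forall>c\<in>A. \<forall>d\<in>A. p \<in> fst c \<longrightarrow> p \<in> fst d \<longrightarrow>
            v d = map_matrix of_real (jacobian c d p) *v v c) \<and>
         (\<forall>c. \<not> (c \<in> A \<and> p \<in> fst c) \<longrightarrow> v c = 0)}"

type_synonym ('a, 'n, 'k) vfield = "'a \<Rightarrow> ('a, 'n, 'k) tvec"

definition vector_field ::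
    "'a topology \<Rightarrow> ('a, 'n::finite) chart set
      \<Rightarrow> ('a, 'n, 'k::{real_normed_field,euclidean_space}) vfield \<Rightarrow> bool" where
  "vector_field M A X \<longleftrightarrow>
     (\<forall>p\<in>topspace M. X p \<in> tangent_space A p) \<and>
     (\<forall>c\<in>A. smooth_on (snd c ` fst c) (\<lambda>x. X (chart_inv c x) c))"

definition vanishes_on :: "'a topology \<Rightarrow> ('a, 'n::finite, 'k::zero) vfield \<Rightarrow> bool" where
  "vanishes_on M Z \<longleftrightarrow> (\<forall>p\<in>topspace M. Z p = (\<lambda>c. 0))"

text \<open>In a chart, the j-th component of [X,Y] is the sum over i of
  X^i d_i Y^j - Y^i d_i X^j.\<close>

definition lie_bracket ::
    "('a, 'n::finite) chart set \<Rightarrow> ('a, 'n, 'k::{real_normed_field,euclidean_space}) vfield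
      \<Rightarrow> ('a, 'n, 'k) vfield \<Rightarrow> ('a, 'n, 'k) vfield" where
  "lie_bracket A X Y p c =
     (if c \<in> A \<and> p \<in> fst c then
        (\<chi> j. \<Sum>i\<in>UNIV.
           X p c $ i *
             frechet_derivative (\<lambda>x. Y (chart_inv c x) c $ j) (at (snd c p)) (axis i 1)
         - Y p c $ i *
             frechet_derivative (\<lambda>x. X (chart_inv c x) c $ j) (at (snd c p)) (axis i 1))
      else 0)"

text \<open>A (1,1)-tensor at a point is given by its matrices with respect to the charts.\<close>

type_synonym ('a, 'n, 'k) tensor11 = "'a \<Rightarrow> ('a, 'n) chart \<Rightarrow> 'k ^ 'n ^ 'n"

definition tensor_field11 ::
    "'a topology \<Rightarrow> ('a, 'n::finite) chart set \<Rightarrow> ('a, 'n, real) tensor11 \<Rightarrow> bool" where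
  "tensor_field11 M A T \<longleftrightarrow>
     (\<forall>c\<in>A. \<forall>d\<in>A. \<forall>p \<in> fst c \<inter> fst d.
        T p d ** jacobian c d p = jacobian c d p ** T p c) \<and>
     (\<forall>c\<in>A. smooth_on (snd c ` fst c) (\<lambda>x. T (chart_inv c x) c))"

definition tapply ::
    "('a, 'n::finite, 'k::semiring_1) tensor11 \<Rightarrow> ('a, 'n, 'k) vfield \<Rightarrow> ('a, 'n, 'k) vfield" where
  "tapply T X p c = T p c *v X p c"

definition nijenhuis ::
    "('a, 'n::finite) chart set \<Rightarrow> ('a, 'n, 'k::{real_normed_field,euclidean_space}) tensor11
      \<Rightarrow> ('a, 'n, 'k) vfield \<Rightarrow> ('a, 'n, 'k) vfield \<Rightarrow> ('a, 'n, 'k) vfield" where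
  "nijenhuis A T X Y p c =
     lie_bracket A (tapply T X) (tapply T Y) p c
     - tapply T (lie_bracket A (tapply T X) Y) p c
     - tapply T (lie_bracket A X (tapply T Y)) p c
     + tapply T (tapply T (lie_bracket A X Y)) p c"

text \<open>Extension of scalars, from T_p M to its tensor product with 'k (the identity for
  'k = real).\<close>

definition ext_vfield ::
    "('a, 'n::finite, real) vfield \<Rightarrow> ('a, 'n, 'k::real_algebra_1) vfield" where
  "ext_vfield X p c = (\<chi> i. of_real (X p c $ i))"

definition ext_tensor ::
    "('a, 'n::finite, real) tensor11 \<Rightarrow> ('a, 'n, 'k::real_algebra_1) tensor11" where
  "ext_tensor T p c = map_matrix of_real (T p c)"

section \<open>Distributions and integrability\<close>

text \<open>A distribution assigns to each point a subspace of the (complexified) tangent space.\<close>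

type_synonym ('a, 'n, 'k) distribution = "'a \<Rightarrow> ('a, 'n, 'k) tvec set"

definition image_distribution ::
    "('a, 'n::finite) chart set \<Rightarrow> ('a, 'n, 'k::{real_normed_field,euclidean_space}) tensor11
      \<Rightarrow> ('a, 'n, 'k) distribution" where
  "image_distribution A T p = (\<lambda>v c. T p c *v v c) ` tangent_space A p"

text \<open>Image of the (complexified) tangent space of N at q under the differential of the inclusion
  of N into M.\<close>

definition inclusion_image ::
    "('a, 'r::finite) chart set \<Rightarrow> ('a, 'n::finite) chart set \<Rightarrow> 'a
      \<Rightarrow> ('a, 'n, 'k::{real_normed_field,euclidean_space}) tvec set" where
  "inclusion_image B A q =
     {w \<in> tangent_space A q. \<exists>v \<in> tangent_space B q.
        \<forall>d\<in>B. \<forall>c\<in>A. q \<in> fst d \<longrightarrow> q \<in> fst c \<longrightarrow>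
          w c = map_matrix of_real (jacobian d c q) *v v d}"

definition integral_manifold ::
    "'a topology \<Rightarrow> ('a, 'r::finite) chart set \<Rightarrow> 'a topology \<Rightarrow> ('a, 'n::finite) chart set
      \<Rightarrow> ('a, 'n, 'k::{real_normed_field,euclidean_space}) distribution \<Rightarrow> bool" where
  "integral_manifold N B M A D \<longleftrightarrow>
     immersed_submanifold N B M A \<and> (\<forall>q\<in>topspace N. inclusion_image B A q = D q)"

text \<open>Integrability of a distribution of dimension CARD('r). The type argument fixes the
  dimension of the integral manifolds, which equals that of the distribution.\<close>

definition integrable_distribution ::
    "'r::finite itself \<Rightarrow> 'a topology \<Rightarrow> ('a, 'n::finite) chart set
      \<Rightarrow> ('a, 'n, 'k::{real_normed_field,euclidean_space}) distribution \<Rightarrow> bool" where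
  "integrable_distribution _ M A D \<longleftrightarrow>
     (\<forall>p\<in>topspace M. \<exists>N (B :: ('a, 'r) chart set). p \<in> topspace N \<and> integral_manifold N B M A D)"

section \<open>F-structure manifolds of degree K\<close>

text \<open>On matrices, \<open>*\<close> and \<open>^\<close> are componentwise, so powers with respect to \<open>**\<close> are needed.\<close>

definition mpow :: "'k::semiring_1 ^ 'n::finite ^ 'n \<Rightarrow> nat \<Rightarrow> 'k ^ 'n ^ 'n" where
  "mpow T k = (((**) T) ^^ k) (mat 1)"

definition mscale :: "'k::semiring_1 \<Rightarrow> 'k ^ 'n::finite ^ 'n \<Rightarrow> 'k ^ 'n ^ 'n" where
  "mscale a = map_matrix ((*) a)"

definition F_structure_manifold ::
    "'a topology \<Rightarrow> ('a, 'n::finite) chart set \<Rightarrow> ('a, 'n, real) tensor11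
      \<Rightarrow> 'k::{real_normed_field,euclidean_space} \<Rightarrow> 'k \<Rightarrow> nat \<Rightarrow> nat \<Rightarrow> bool" where
  "F_structure_manifold M A F \<alpha> \<beta> K r \<longleftrightarrow>
     smooth_manifold M A \<and> tensor_field11 M A F \<and> 3 \<le> K \<and>
     (\<exists>c\<in>A. \<exists>p\<in>fst c. F p c \<noteq> 0) \<and>
     (\<forall>c\<in>A. \<forall>p\<in>fst c. rank (F p c) = r) \<and>
     (\<forall>c\<in>A. \<forall>p\<in>fst c.
        mscale \<alpha> (mpow (ext_tensor F p c) (K + 1)) + mscale \<beta> (mpow (ext_tensor F p c) K)
          + ext_tensor F p c = 0)"

definition proj_l ::
    "('a, 'n::finite, real) tensor11 \<Rightarrow> 'k::{real_normed_field,euclidean_space} \<Rightarrow> 'k \<Rightarrow> nat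
      \<Rightarrow> ('a, 'n, 'k) tensor11" where
  "proj_l F \<alpha> \<beta> K p c =
     - (mscale \<alpha> (mpow (ext_tensor F p c) K) + mscale \<beta> (mpow (ext_tensor F p c) (K - 1)))"

definition proj_m ::
    "('a, 'n::finite, real) tensor11 \<Rightarrow> 'k::{real_normed_field,euclidean_space} \<Rightarrow> 'k \<Rightarrow> nat
      \<Rightarrow> ('a, 'n, 'k) tensor11" where
  "proj_m F \<alpha> \<beta> K p c =
     mat 1 + mscale \<alpha> (mpow (ext_tensor F p c) K) + mscale \<beta> (mpow (ext_tensor F p c) (K - 1))"

end

theory Submission
  imports Defs
begin

text \<open>
  Let \<open>\<tau>\<close> be a real-linear functional on the scalars that is the identity on the reals. Since \<open>F\<close> is real,
  replacing \<open>\<alpha>\<close> and \<open>\<beta>\<close> by their images under \<open>\<tau>\<close> does not change \<open>l\<close>, which is the projection onto the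
  image of \<open>F\<close> along its kernel; hence \<open>l\<close> is the extension of a smooth real projection field \<open>L\<close> of
  constant rank. As \<open>l\<close> is idempotent, \<open>N\<^sub>l(lX,lY) = m[lX,lY]\<close>, and in a chart
  \<open>m[lX,lY] = DL(LX)(LY) - DL(LY)(LX)\<close>. Because bump functions produce vector fields with any
  prescribed value at a point, both conditions say that the derivative of \<open>L\<close> is symmetric on its image.

  If \<open>\<phi>\<close> parametrizes an integral manifold, differentiating \<open>L(\<phi>) D\<phi> = D\<phi>\<close> and using the symmetry
  of the second derivative gives this symmetry. Conversely, the symmetry makes a suitable frame \<open>B\<close> of the
  image commute, and the total differential equation \<open>D\<phi> = B(\<phi>)\<close> is solved by integrating along
  rays from the origin; its solutions are integral manifolds.
\<close>

section \<open>Calculus of smooth maps\<close>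

text \<open>Why \<tau> loses nothing: the identity gives l T = T l = T for T = F, and l is T times a
  polynomial in T. Since T is real, applying \<tau> entrywise yields L T = T L = T and L = T Y for
  some Y; then l L equals L because l fixes the image of T, and equals l because T L = T. Why
  m[lX,lY] is a pointwise object: differentiating L(LZ) = LZ gives (1 - L) D(LZ) = DL(.)(LZ), so no
  derivative of X or Y survives. For the converse, a construction by flows would call for smooth
  dependence on initial data. Instead the time interval is fixed as [0,1] and smallness is carried
  by the parameter y. The time-one map is differentiated by a direct estimate, and its higher
  smoothness is read off from D\<phi> = B(\<phi>). The image of \<phi> must then become a manifold
  inside M. The constant matrix P with P B = 1 gives P \<phi>(y) = y + const, so \<phi> has a
  continuous left inverse; this serves as the single chart, for the subspace topology.\<close>

lemma Ck_on_subset: "Ck_on k S f \<Longrightarrow> T \<subseteq> S \<Longrightarrow> Ck_on k T f"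
  by (induction k arbitrary: f) (auto intro: continuous_on_subset)

lemma Ck_on_cong:
  assumes "open S" "\<And>x. x \<in> S \<Longrightarrow> f x = g x" "Ck_on k S f"
  shows "Ck_on k S g"
  using assms(2,3)
proof (induction k arbitrary: f g)
  case 0
  then show ?case by (simp cong: continuous_on_cong)
next
  case (Suc k)
  have g: "(g has_derivative frechet_derivative f (at x)) (at x)" if "x \<in> S" for x
    using Suc.prems that assms(1)
    using has_derivative_transform_within_open[of f _ x UNIV S g]
    by (simp add: frechet_derivative_works)
  then have eq: "frechet_derivative f (at x) = frechet_derivative g (at x)" if "x \<in> S" for x
    using frechet_derivative_at that by blast
  show ?case
    unfolding Ck_on.simps
  proof (intro conjI ballI allI)
    show "g differentiable at x" if "x \<in> S" for x
      using g[OF that] differentiable_def by blast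
    show "Ck_on k S (\<lambda>x. frechet_derivative g (at x) v)" for v
      by (rule Suc.IH[of "\<lambda>x. frechet_derivative f (at x) v"]) (use eq Suc.prems in auto)
  qed
qed

lemma Ck_on_Suc_D: "Ck_on (Suc k) S f \<Longrightarrow> Ck_on k S f"
proof (induction k arbitrary: f)
  case 0
  then show ?case
    by (auto intro!: differentiable_imp_continuous_on differentiable_at_imp_differentiable_on)
next
  case (Suc k)
  then show ?case
    by (metis Ck_on.simps(2))
qed

lemma Ck_on_local:
  assumes "\<And>x. x \<in> S \<Longrightarrow> \<exists>U. open U \<and> x \<in> U \<and> Ck_on k U f"
  shows "Ck_on k S f"
  using assms
proof (induction k arbitrary: f)
  case 0
  then have "isCont f x" if "x \<in> S" for x
    using that by (metis Ck_on.simps(1) continuous_on_eq_continuous_at)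
  then show ?case
    by (simp add: continuous_at_imp_continuous_on)
next
  case (Suc k)
  show ?case
    unfolding Ck_on.simps
  proof (intro conjI ballI allI)
    show "f differentiable at x" if "x \<in> S" for x
      using Suc.prems[OF that] by auto
    show "Ck_on k S (\<lambda>x. frechet_derivative f (at x) v)" for v
      using Suc.prems by (intro Suc.IH) (metis Ck_on.simps(2))
  qed
qed

text \<open>\<open>frechet_derivative\<close> is a choice operator. Uniqueness of derivatives at
  interior points allows any explicit formula \<open>f'\<close> in its place.\<close>

lemma Ck_on_SucI:
  assumes "open S" "\<And>x. x \<in> S \<Longrightarrow> (f has_derivative f' x) (at x)" "\<And>v. Ck_on k S (\<lambda>x. f' x v)"
  shows "Ck_on (Suc k) S f"
  unfolding Ck_on.simps
proof (intro conjI ballI allI)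
  show "f differentiable at x" if "x \<in> S" for x
    using assms that differentiable_def by blast
  show "Ck_on k S (\<lambda>x. frechet_derivative f (at x) v)" for v
    by (rule Ck_on_cong[OF assms(1) _ assms(3)[of v]])
      (use assms(2) frechet_derivative_at in metis)
qed

lemma Ck_on_Suc_has_derivative:
  "Ck_on (Suc k) S f \<Longrightarrow> x \<in> S \<Longrightarrow> (f has_derivative frechet_derivative f (at x)) (at x)"
  by (simp add: frechet_derivative_works)

lemma Ck_on_const: "open S \<Longrightarrow> Ck_on k S (\<lambda>x. c)"
proof (induction k arbitrary: c)
  case (Suc k)
  then show ?case by (intro Ck_on_SucI[where f' = "\<lambda>_ _. 0"]) auto
qed simp

lemma Ck_on_bounded_linear:
  assumes "open S" "bounded_linear h" "Ck_on k S f"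
  shows "Ck_on k S (\<lambda>x. h (f x))"
  using assms(3)
proof (induction k arbitrary: f)
  case 0
  then show ?case
    using bounded_linear.continuous_on[OF assms(2)] by simp
next
  case (Suc k)
  show ?case
  proof (rule Ck_on_SucI[OF assms(1)])
    show "((\<lambda>x. h (f x)) has_derivative (\<lambda>v. h (frechet_derivative f (at x) v))) (at x)" if "x \<in> S" for x
      using bounded_linear.has_derivative[OF assms(2) Ck_on_Suc_has_derivative[OF Suc.prems that]] .
  qed (use Suc in auto)
qed

lemma Ck_on_add:
  assumes "open S" "Ck_on k S f" "Ck_on k S g"
  shows "Ck_on k S (\<lambda>x. f x + g x)"
  using assms(2,3)
proof (induction k arbitrary: f g)
  case 0
  then show ?case by (auto intro: continuous_intros)
next
  case (Suc k)
  show ?case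
    using Suc by (intro Ck_on_SucI[OF assms(1) has_derivative_add[OF Ck_on_Suc_has_derivative
          Ck_on_Suc_has_derivative]]) auto
qed

lemma Ck_on_sum:
  assumes "open S" "\<And>i. i \<in> I \<Longrightarrow> Ck_on k S (f i)"
  shows "Ck_on k S (\<lambda>x. \<Sum>i\<in>I. f i x)"
  using assms(2)
  by (induction I rule: infinite_finite_induct)
    (auto simp: assms(1) intro!: Ck_on_const Ck_on_add)

text \<open>The product rule yields two terms of the same bilinear shape with one factor
  differentiated and the other merely lowered by \<open>Ck_on_Suc_D\<close>, so the induction
  generalizes over both factors.\<close>

lemma Ck_on_bounded_bilinear:
  assumes "open S" "bounded_bilinear h" "Ck_on k S f" "Ck_on k S g"
  shows "Ck_on k S (\<lambda>x. h (f x) (g x))"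
  using assms(3,4)
proof (induction k arbitrary: f g)
  case 0
  then show ?case
    using bounded_bilinear.continuous_on[OF assms(2)] by simp
next
  case (Suc k)
  show ?case
    using Suc(2,3) by (intro Ck_on_SucI[OF assms(1) bounded_bilinear.FDERIV[OF assms(2)
        Ck_on_Suc_has_derivative Ck_on_Suc_has_derivative]] Ck_on_add[OF assms(1)] Suc.IH)
     (auto intro: Ck_on_Suc_D simp del: Ck_on.simps, auto)
qed

lemma linear_Basis_expansion:
  fixes f :: "'v::euclidean_space \<Rightarrow> 'w::real_vector"
  assumes "linear f"
  shows "f v = (\<Sum>b\<in>Basis. (v \<bullet> b) *\<^sub>R f b)"
  by (subst (1) euclidean_representation[of v, symmetric])
    (simp only: linear_sum[OF assms] linear_cmul[OF assms])

lemma Ck_on_compose: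
  assumes "open S" "open T" "f ` S \<subseteq> T" "Ck_on k S f" "Ck_on k T g"
  shows "Ck_on k S (\<lambda>x. g (f x))"
  using assms(4,5)
proof (induction k arbitrary: g)
  case 0
  then show ?case
    using assms(3) continuous_on_compose2[of T g S f] by simp
next
  case (Suc k)
  \<comment> \<open>\<open>Ck_on\<close> controls derivatives only in fixed directions, but the
    chain rule evaluates the outer derivative in the moving direction Df(x) v. Expanding that
    direction over the basis leaves only fixed directions.\<close>
  let ?D = "\<lambda>x v. \<Sum>b\<in>Basis. (frechet_derivative f (at x) v \<bullet> b) *\<^sub>R frechet_derivative g (at (f x)) b"
  show ?case
  proof (rule Ck_on_SucI[OF assms(1)])
    fix x assume x: "x \<in> S"
    then have dg: "(g has_derivative frechet_derivative g (at (f x))) (at (f x))"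
      using assms(3) Ck_on_Suc_has_derivative[OF Suc.prems(2)] by auto
    have "((\<lambda>x. g (f x)) has_derivative
        (\<lambda>v. frechet_derivative g (at (f x)) (frechet_derivative f (at x) v))) (at x)"
      using has_derivative_compose[OF Ck_on_Suc_has_derivative[OF Suc.prems(1) x] dg] .
    moreover have "(\<lambda>v. frechet_derivative g (at (f x)) (frechet_derivative f (at x) v)) = ?D x"
      using linear_Basis_expansion[OF has_derivative_linear[OF dg]] by blast
    ultimately show "((\<lambda>x. g (f x)) has_derivative ?D x) (at x)"
      by (simp only:)
  next
    fix v
    have "Ck_on k S (\<lambda>x. frechet_derivative g (at (f x)) b)" for b
      by (rule Suc.IH) (use Suc.prems in \<open>auto intro: Ck_on_Suc_D simp del: Ck_on.simps\<close>, use Suc.prems in auto)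
    moreover have "Ck_on k S (\<lambda>x. frechet_derivative f (at x) v \<bullet> b)" for b
      by (rule Ck_on_bounded_linear[OF assms(1) bounded_linear_inner_left]) (use Suc.prems(1) in auto)
    ultimately show "Ck_on k S (\<lambda>x. ?D x v)"
      by (intro Ck_on_sum[OF assms(1)] Ck_on_bounded_bilinear[OF assms(1) bounded_bilinear_scaleR])
  qed
qed

lemma Ck_on_id: "open S \<Longrightarrow> Ck_on k S (\<lambda>x. x)"
  by (rule Ck_on_Suc_D, rule Ck_on_SucI[where f' = "\<lambda>_ v. v"]) (auto intro: Ck_on_const)

lemma smooth_on_subset: "smooth_on S f \<Longrightarrow> T \<subseteq> S \<Longrightarrow> smooth_on T f"
  unfolding smooth_on_def using Ck_on_subset by blast

lemma smooth_on_cong: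
  "open S \<Longrightarrow> (\<And>x. x \<in> S \<Longrightarrow> f x = g x) \<Longrightarrow> smooth_on S f \<Longrightarrow> smooth_on S g"
  unfolding smooth_on_def using Ck_on_cong[of S f g] by blast

lemma smooth_on_local:
  "(\<And>x. x \<in> S \<Longrightarrow> \<exists>U. open U \<and> x \<in> U \<and> smooth_on U f) \<Longrightarrow> smooth_on S f"
  unfolding smooth_on_def by (meson Ck_on_local)

lemma smooth_on_const: "open S \<Longrightarrow> smooth_on S (\<lambda>x. c)"
  and smooth_on_id: "open S \<Longrightarrow> smooth_on S (\<lambda>x. x)"
  unfolding smooth_on_def by (auto intro: Ck_on_const Ck_on_id)

lemma smooth_on_bounded_linear:
  "open S \<Longrightarrow> bounded_linear h \<Longrightarrow> smooth_on S f \<Longrightarrow> smooth_on S (\<lambda>x. h (f x))"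
  unfolding smooth_on_def by (simp add: Ck_on_bounded_linear)

lemma smooth_on_bounded_bilinear:
  "open S \<Longrightarrow> bounded_bilinear h \<Longrightarrow> smooth_on S f \<Longrightarrow> smooth_on S g \<Longrightarrow> smooth_on S (\<lambda>x. h (f x) (g x))"
  unfolding smooth_on_def by (simp add: Ck_on_bounded_bilinear)

lemmas smooth_on_scaleR = smooth_on_bounded_bilinear[OF _ bounded_bilinear_scaleR]
  and smooth_on_mult = smooth_on_bounded_bilinear[OF _ bounded_bilinear_mult]

lemma smooth_on_add:
  "open S \<Longrightarrow> smooth_on S f \<Longrightarrow> smooth_on S g \<Longrightarrow> smooth_on S (\<lambda>x. f x + g x)"
  unfolding smooth_on_def by (simp add: Ck_on_add)

lemma smooth_on_sum:
  "open S \<Longrightarrow> (\<And>i. i \<in> I \<Longrightarrow> smooth_on S (f i)) \<Longrightarrow> smooth_on S (\<lambda>x. \<Sum>i\<in>I. f i x)"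
  unfolding smooth_on_def by (simp add: Ck_on_sum)

lemmas smooth_on_minus = smooth_on_bounded_linear[OF _ bounded_linear_minus[OF bounded_linear_ident]]
  and smooth_on_vec_nth = smooth_on_bounded_linear[OF _ bounded_linear_vec_nth]

lemma smooth_on_prod:
  fixes f :: "'i \<Rightarrow> 'v::euclidean_space \<Rightarrow> 'w::{real_normed_algebra,comm_ring_1}"
  assumes "open S" "\<And>i. i \<in> I \<Longrightarrow> smooth_on S (f i)"
  shows "smooth_on S (\<lambda>x. \<Prod>i\<in>I. f i x)"
  using assms(2)
  by (induction I rule: infinite_finite_induct)
    (auto simp: assms(1) intro!: smooth_on_const smooth_on_mult)

lemma smooth_on_compose:
  "open S \<Longrightarrow> open T \<Longrightarrow> f ` S \<subseteq> T \<Longrightarrow> smooth_on S f \<Longrightarrow> smooth_on T g \<Longrightarrow> smooth_on S (\<lambda>x. g (f x))"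
  unfolding smooth_on_def by (auto intro: Ck_on_compose[of S T f _ g])

lemma smooth_on_has_derivative:
  "smooth_on S f \<Longrightarrow> x \<in> S \<Longrightarrow> (f has_derivative frechet_derivative f (at x)) (at x)"
  unfolding smooth_on_def using Ck_on_Suc_has_derivative by blast

lemma smooth_on_frechet_derivative:
  "smooth_on S f \<Longrightarrow> smooth_on S (\<lambda>x. frechet_derivative f (at x) v)"
  unfolding smooth_on_def using Ck_on.simps(2) by blast

lemma smooth_on_continuous_on: "smooth_on S f \<Longrightarrow> continuous_on S f"
  unfolding smooth_on_def using Ck_on.simps(1) by blast

lemma smooth_on_inverse:
  fixes f :: "'v::euclidean_space \<Rightarrow> real"
  assumes "open S" "smooth_on S f" "\<And>x. x \<in> S \<Longrightarrow> f x \<noteq> 0"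
  shows "smooth_on S (\<lambda>x. inverse (f x))"
proof -
  have "Ck_on k S (\<lambda>x. inverse (f x))" for k
  proof (induction k)
    case 0
    then show ?case
      using assms(3) smooth_on_continuous_on[OF assms(2)] by (auto intro!: continuous_intros)
  next
    case (Suc k)
    show ?case
    proof (rule Ck_on_SucI[OF assms(1)])
      show "((\<lambda>x. inverse (f x)) has_derivative
          (\<lambda>v. - (inverse (f x) * frechet_derivative f (at x) v * inverse (f x)))) (at x)"
        if "x \<in> S" for x
        using assms(3)[OF that] smooth_on_has_derivative[OF assms(2) that]
        \<comment> \<open>This expression contains only 1/f and Df, so the induction hypothesis on
          1/f supplies the next order.\<close>
        by (rule Deriv.has_derivative_inverse)
      have "Ck_on k S (\<lambda>x. frechet_derivative f (at x) v)" for v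
        using smooth_on_frechet_derivative[OF assms(2)] unfolding smooth_on_def by blast
      then show "Ck_on k S (\<lambda>x. - (inverse (f x) * frechet_derivative f (at x) v * inverse (f x)))" for v
        using Suc assms(1)
        by (intro Ck_on_bounded_linear[OF _ bounded_linear_minus[OF bounded_linear_ident]]
            Ck_on_bounded_bilinear[OF _ bounded_bilinear_mult])
    qed
  qed
  then show ?thesis
    unfolding smooth_on_def by blast
qed

section \<open>Smooth vector- and matrix-valued maps\<close>

lemma bounded_linear_axis: "bounded_linear (axis i :: 'a::real_normed_vector \<Rightarrow> 'a ^ 'n)"
proof (rule bounded_linear_intro[where K = 1])
  show "norm (axis i x :: 'a ^ 'n) \<le> norm x * 1" for x
    by (simp add: norm_vec_def axis_def L2_set_def if_distrib[where f = "\<lambda>x. (norm x)\<^sup>2"]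
        cong: if_cong)
qed (auto simp: vec_eq_iff axis_def)

lemma smooth_on_vec_lambda:
  fixes f :: "'i::finite \<Rightarrow> 'v::euclidean_space \<Rightarrow> 'w::real_normed_vector"
  assumes "open S" "\<And>i. smooth_on S (f i)"
  shows "smooth_on S (\<lambda>x. \<chi> i. f i x)"
proof -
  have "(\<chi> i. f i x) = (\<Sum>i\<in>UNIV. axis i (f i x))" for x
    by (simp add: vec_eq_iff axis_def if_distrib[where f="\<lambda>x. x $ _"])
  then show ?thesis
    using assms by (auto intro!: smooth_on_sum smooth_on_bounded_linear[OF _ bounded_linear_axis])
qed


lemma smooth_on_vec_iff:
  fixes f :: "'v::euclidean_space \<Rightarrow> 'w::real_normed_vector ^ 'i::finite"
  assumes "open S"
  shows "smooth_on S f \<longleftrightarrow> (\<forall>i. smooth_on S (\<lambda>x. f x $ i))"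
  using smooth_on_vec_lambda[OF assms, of "\<lambda>i x. f x $ i"] smooth_on_vec_nth[OF assms, of f] by auto

lemma smooth_on_matrix_vector_mult:
  fixes T :: "'v::euclidean_space \<Rightarrow> 'w::real_normed_field ^ 'n::finite ^ 'm::finite"
  assumes "open S" "smooth_on S T" "smooth_on S f"
  shows "smooth_on S (\<lambda>x. T x *v f x)"
  unfolding matrix_vector_mult_def
  using assms(2-)[unfolded smooth_on_vec_iff[OF assms(1)]] assms(1)
  by (intro smooth_on_vec_lambda smooth_on_sum smooth_on_mult) auto

lemma smooth_on_matrix_matrix_mult:
  fixes T :: "'v::euclidean_space \<Rightarrow> 'w::real_normed_field ^ 'n::finite ^ 'm::finite"
  assumes "open S" "smooth_on S T" "smooth_on S U"
  shows "smooth_on S (\<lambda>x. T x ** U x)"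
  unfolding matrix_matrix_mult_def
  using assms(2-)[unfolded smooth_on_vec_iff[OF assms(1)]] assms(1)
  by (intro smooth_on_vec_lambda smooth_on_sum smooth_on_mult) auto

lemma smooth_on_matrix_columns:
  fixes T :: "'v::euclidean_space \<Rightarrow> real ^ 'n::finite ^ 'm::finite"
  assumes "open S" "\<And>v. smooth_on S (\<lambda>x. T x *v v)"
  shows "smooth_on S T"
proof -
  have "smooth_on S (\<lambda>x. T x $ i $ j)" for i j
    using smooth_on_vec_nth[OF assms(1) assms(2)[of "axis j 1"], of i]
    by (simp add: matrix_vector_mul_component inner_axis)
  then show ?thesis
    by (simp add: smooth_on_vec_iff[OF assms(1)])
qed

lemma smooth_on_det:
  fixes T :: "'v::euclidean_space \<Rightarrow> real ^ 'n::finite ^ 'n"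
  assumes "open S" "smooth_on S T"
  shows "smooth_on S (\<lambda>x. det (T x))"
  unfolding det_def
  using assms(2-)[unfolded smooth_on_vec_iff[OF assms(1)]] assms(1)
  by (intro smooth_on_sum smooth_on_mult smooth_on_const smooth_on_prod) auto

lemma matrix_inv_inverse:
  fixes T :: "'a::semiring_1 ^ 'n ^ 'm"
  assumes "invertible T"
  shows "T ** matrix_inv T = mat 1" "matrix_inv T ** T = mat 1"
  using assms someI_ex[of "\<lambda>T'. T ** T' = mat 1 \<and> T' ** T = mat 1"]
  by (auto simp: invertible_def matrix_inv_def)

text \<open>By Cramer's rule the inverse applied to a fixed vector is a vector of quotients of
  determinants.\<close>

lemma smooth_on_matrix_inv:
  fixes T :: "'v::euclidean_space \<Rightarrow> real ^ 'n::finite ^ 'n"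
  assumes "open S" "smooth_on S T" "\<And>x. x \<in> S \<Longrightarrow> det (T x) \<noteq> 0"
  shows "smooth_on S (\<lambda>x. matrix_inv (T x))"
proof (rule smooth_on_matrix_columns[OF assms(1)])
  fix v
  let ?C = "\<lambda>x. \<chi> k. det (\<chi> i j. if j = k then v $ i else T x $ i $ j) * inverse (det (T x))"
  have "?C x = matrix_inv (T x) *v v" if "x \<in> S" for x
  proof -
    have "T x *v (matrix_inv (T x) *v v) = v"
      using assms(3)[OF that]
      by (simp add: matrix_vector_mul_assoc matrix_inv_inverse invertible_det_nz)
    then show ?thesis
      using cramer[OF assms(3)[OF that]] by (simp add: divide_inverse)
  qed
  moreover have "smooth_on S ?C"
  proof (intro smooth_on_vec_lambda smooth_on_mult smooth_on_det smooth_on_inverse assms)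
    show "smooth_on S (\<lambda>x. if j = k then v $ i else T x $ i $ j)" for i j k
      using assms(1,2) by (cases "j = k") (auto simp: smooth_on_vec_iff intro: smooth_on_const)
  qed auto
  ultimately show "smooth_on S (\<lambda>x. matrix_inv (T x) *v v)"
    by (rule smooth_on_cong[OF assms(1)])
qed

section \<open>Symmetry of second derivatives\<close>

lemma symmetric_second_derivative_real:
  fixes f :: "'v::euclidean_space \<Rightarrow> real"
  assumes "open S" "x \<in> S" "Ck_on 2 S f"
  shows "frechet_derivative (\<lambda>x. frechet_derivative f (at x) u) (at x) v =
         frechet_derivative (\<lambda>x. frechet_derivative f (at x) v) (at x) u"
proof -
  define D where "D u x = frechet_derivative f (at x) u" for u x
  define D2 where "D2 u v x = frechet_derivative (D u) (at x) v" for u v x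
  have dD: "((\<lambda>t. f (a + t *\<^sub>R w)) has_real_derivative D w (a + t *\<^sub>R w)) (at t)"
    if "a + t *\<^sub>R w \<in> S" for a w t
  proof -
    have "(f has_derivative frechet_derivative f (at (a + t *\<^sub>R w))) (at (a + t *\<^sub>R w))"
      using assms(3) that by (simp add: frechet_derivative_works numeral_2_eq_2)
    note d = this
    have "((\<lambda>t. a + t *\<^sub>R w) has_derivative (\<lambda>h. h *\<^sub>R w)) (at t)"
      by (auto intro!: derivative_eq_intros)
    from diff_chain_at[OF this d]
    show ?thesis
      using linear_cmul[OF has_derivative_linear[OF d]]
      by (simp add: has_field_derivative_def D_def o_def mult_commute_abs)
  qed
  have dD2: "((\<lambda>t. D u (a + t *\<^sub>R w)) has_real_derivative D2 u w (a + t *\<^sub>R w)) (at t)"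
    if "a + t *\<^sub>R w \<in> S" for a u w t
  proof -
    have "(D u has_derivative frechet_derivative (D u) (at (a + t *\<^sub>R w))) (at (a + t *\<^sub>R w))"
      using assms(3) that by (simp add: frechet_derivative_works[symmetric] numeral_2_eq_2 D_def[abs_def])
    note d = this
    have "((\<lambda>t. a + t *\<^sub>R w) has_derivative (\<lambda>h. h *\<^sub>R w)) (at t)"
      by (auto intro!: derivative_eq_intros)
    from diff_chain_at[OF this d]
    show ?thesis
      using linear_cmul[OF has_derivative_linear[OF d]]
      by (simp add: has_field_derivative_def D2_def o_def mult_commute_abs)
  qed
  have cont: "isCont (D2 u v) x" for u v
    using assms by (simp add: D2_def[abs_def] D_def[abs_def] numeral_2_eq_2 continuous_on_eq_continuous_at)
  \<comment> \<open>The second difference is symmetric in u and v. Two applications of the mean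
    value theorem, first along u and then along v, turn it into s^2 times a value of
    \<open>D2 u v\<close> near x, so its quotient by s^2 has both mixed derivatives as
    limit.\<close>
  define \<Delta> where "\<Delta> s u v = f (x + s *\<^sub>R u + s *\<^sub>R v) - f (x + s *\<^sub>R u) - f (x + s *\<^sub>R v) + f x" for s u v
  have lim: "((\<lambda>s. \<Delta> s u v / s\<^sup>2) \<longlongrightarrow> D2 u v x) (at_right 0)" for u v
  proof (rule tendstoI)
    fix e :: real assume "e > 0"
    obtain \<delta> where \<delta>: "\<delta> > 0" "ball x \<delta> \<subseteq> S" "\<And>y. y \<in> ball x \<delta> \<Longrightarrow> dist (D2 u v y) (D2 u v x) < e"
    proof -
      obtain d1 where "d1 > 0" "ball x d1 \<subseteq> S"
        using assms openE by blast
      moreover obtain d2 where "d2 > 0" "\<And>y. dist y x < d2 \<Longrightarrow> dist (D2 u v y) (D2 u v x) < e"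
        using cont[of u v] \<open>e > 0\<close> unfolding continuous_at_eps_delta by blast
      ultimately show thesis
        by (intro that[of "min d1 d2"]) (auto simp: dist_commute)
    qed
    \<comment> \<open>Keeps the whole parallelogram used below inside the ball; the summand 1 covers
      u = v = 0.\<close>
    define r where "r = \<delta> / (norm u + norm v + 1)"
    have r: "r > 0"
      using \<delta>(1) by (auto simp: r_def intro!: divide_pos_pos add_nonneg_pos)
    have mem: "x + a *\<^sub>R u + b *\<^sub>R v \<in> ball x \<delta>" if "0 \<le> a" "0 \<le> b" "a < r" "b < r" for a b
    proof -
      have "norm (a *\<^sub>R u + b *\<^sub>R v) \<le> a * norm u + b * norm v"
        using that norm_triangle_ineq[of "a *\<^sub>R u" "b *\<^sub>R v"] by simp
      also have "\<dots> \<le> r * norm u + r * norm v"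
        using that by (intro add_mono mult_right_mono) auto
      also have "\<dots> < r * (norm u + norm v + 1)"
        using r by (simp add: algebra_simps)
      also have "\<dots> = \<delta>"
        unfolding r_def by (smt (verit) nonzero_eq_divide_eq norm_ge_zero)
      moreover have "dist x (x + (a *\<^sub>R u + b *\<^sub>R v)) = norm (a *\<^sub>R u + b *\<^sub>R v)"
        by (metis add_diff_cancel_left' dist_commute dist_norm)
      ultimately show ?thesis
        by (simp add: add.assoc)
    qed
    have "dist (\<Delta> s u v / s\<^sup>2) (D2 u v x) < e" if s: "0 < s" "s < r" for s
    proof -
      have "\<exists>z. 0 < z \<and> z < s \<and>
        (f (x + s *\<^sub>R v + s *\<^sub>R u) - f (x + s *\<^sub>R u)) - (f (x + s *\<^sub>R v + 0 *\<^sub>R u) - f (x + 0 *\<^sub>R u)) =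
        (s - 0) * (D u (x + s *\<^sub>R v + z *\<^sub>R u) - D u (x + z *\<^sub>R u))"
      proof (rule MVT2[OF s(1)])
        fix z assume z: "0 \<le> z" "z \<le> s"
        then show "((\<lambda>t. f (x + s *\<^sub>R v + t *\<^sub>R u) - f (x + t *\<^sub>R u)) has_real_derivative
          D u (x + s *\<^sub>R v + z *\<^sub>R u) - D u (x + z *\<^sub>R u)) (at z)"
          using mem[of z s] mem[of z 0] s \<delta>(2)
          by (intro DERIV_diff dD) (auto simp: add_ac)
      qed
      then obtain z where z: "0 < z" "z < s" "\<Delta> s u v = s * (D u (x + z *\<^sub>R u + s *\<^sub>R v) - D u (x + z *\<^sub>R u))"
        by (auto simp: \<Delta>_def algebra_simps)
      have "\<exists>w. 0 < w \<and> w < s \<and> D u ((x + z *\<^sub>R u) + s *\<^sub>R v) - D u ((x + z *\<^sub>R u) + 0 *\<^sub>R v) =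
        (s - 0) * D2 u v ((x + z *\<^sub>R u) + w *\<^sub>R v)"
        using mem[of z] s z \<delta>(2) by (intro MVT2[OF s(1)] dD2) auto
      then obtain w where w: "0 < w" "w < s" "\<Delta> s u v = s\<^sup>2 * D2 u v (x + z *\<^sub>R u + w *\<^sub>R v)"
        using z by (auto simp: power2_eq_square)
      then show ?thesis
        using \<delta>(3)[OF mem[of z w]] z s by simp
    qed
    then show "\<forall>\<^sub>F s in at_right 0. dist (\<Delta> s u v / s\<^sup>2) (D2 u v x) < e"
      using r by (auto simp: eventually_at_right_field)
  qed
  have "(\<lambda>s. \<Delta> s u v / s\<^sup>2) = (\<lambda>s. \<Delta> s v u / s\<^sup>2)"
    by (auto simp: \<Delta>_def algebra_simps)
  then have "D2 u v x = D2 v u x"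
    using tendsto_unique[OF trivial_limit_at_right_real lim[of u v]] lim[of v u] by simp
  then show ?thesis
    by (simp add: D2_def D_def[abs_def])
qed


lemma frechet_derivative_bounded_linear:
  "bounded_linear h \<Longrightarrow> f differentiable (at x) \<Longrightarrow>
    frechet_derivative (\<lambda>x. h (f x)) (at x) v = h (frechet_derivative f (at x) v)"
  by (metis bounded_linear.has_derivative frechet_derivative_at frechet_derivative_works)

lemma smooth_on_differentiable: "smooth_on S f \<Longrightarrow> x \<in> S \<Longrightarrow> f differentiable (at x)"
  using smooth_on_has_derivative differentiable_def by blast

lemma symmetric_second_derivative:
  fixes f :: "'v::euclidean_space \<Rightarrow> real ^ 'm::finite"
  assumes "open S" "x \<in> S" "smooth_on S f"
  shows "frechet_derivative (\<lambda>x. frechet_derivative f (at x) u) (at x) v =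
         frechet_derivative (\<lambda>x. frechet_derivative f (at x) v) (at x) u"
proof -
  have smi: "smooth_on S (\<lambda>x. f x $ i)" for i
    using smooth_on_vec_nth[OF assms(1,3)] .
  have "frechet_derivative (\<lambda>x. frechet_derivative f (at x) u) (at x) v $ i =
      frechet_derivative (\<lambda>x. frechet_derivative (\<lambda>x. f x $ i) (at x) u) (at x) v" for u v i
  proof -
    have eq: "frechet_derivative (\<lambda>x. f x $ i) (at y) u = frechet_derivative f (at y) u $ i" if "y \<in> S" for y
      by (rule frechet_derivative_bounded_linear[OF bounded_linear_vec_nth smooth_on_differentiable[OF assms(3) that]])
    have "frechet_derivative (\<lambda>x. frechet_derivative (\<lambda>x. f x $ i) (at x) u) (at x) =
        frechet_derivative (\<lambda>x. frechet_derivative f (at x) u $ i) (at x)"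
      by (rule frechet_derivative_transform_within_open[OF _ assms(1,2) eq])
        (rule smooth_on_differentiable[OF smooth_on_frechet_derivative[OF smi] assms(2)])
    then show ?thesis
      using frechet_derivative_bounded_linear[OF bounded_linear_vec_nth
          smooth_on_differentiable[OF smooth_on_frechet_derivative[OF assms(3)] assms(2)], where v = v]
      by simp
  qed
  moreover have "Ck_on 2 S (\<lambda>x. f x $ i)" for i
    using smi unfolding smooth_on_def by blast
  ultimately show ?thesis
    using symmetric_second_derivative_real[OF assms(1,2)] by (simp add: vec_eq_iff)
qed

section \<open>Bump functions\<close>

definition flat_exp :: "nat \<Rightarrow> real \<Rightarrow> real" where
  "flat_exp k t = (if t > 0 then exp (- inverse t) / t ^ k else 0)"

lemma flat_exp_tendsto_0: "(flat_exp k \<longlongrightarrow> 0) (at 0)"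
proof -
  have "((\<lambda>t. inverse t ^ k / exp (inverse t)) \<longlongrightarrow> 0) (at_right (0::real))"
    using filterlim_compose[OF tendsto_power_div_exp_0 filterlim_inverse_at_top_right] .
  then have "(flat_exp k \<longlongrightarrow> 0) (at_right 0)"
    by (rule Lim_transform_eventually)
      (auto simp: eventually_at_right_field flat_exp_def exp_minus power_inverse divide_simps intro!: exI[of _ 1])
  moreover have "(flat_exp k \<longlongrightarrow> 0) (at_left 0)"
    by (rule tendsto_eventually) (auto simp: eventually_at_left_field flat_exp_def intro!: exI[of _ "-1"])
  ultimately show ?thesis
    by (simp add: filterlim_at_split)
qed

text \<open>The powers in the denominator of \<open>flat_exp\<close> are there so that the family is
  closed under differentiation up to linear combinations; smoothness of all members is then a single
  induction.\<close>

lemma flat_exp_has_derivative: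
  "(flat_exp k has_real_derivative flat_exp (k + 2) t - real k * flat_exp (k + 1) t) (at t)"
proof -
  consider "t > 0" | "t < 0" | "t = 0" by linarith
  then show ?thesis
  proof cases
    case 1
    have "((\<lambda>t. exp (- inverse t) / t ^ k) has_real_derivative
        flat_exp (k + 2) t - real k * flat_exp (k + 1) t) (at t)"
      using 1 by (auto intro!: derivative_eq_intros simp: flat_exp_def divide_simps)
        (cases k; auto simp: field_simps power2_eq_square)
    then show ?thesis
      by (rule has_field_derivative_transform_within_open[where S = "{0<..}"])
        (use 1 in \<open>auto simp: flat_exp_def\<close>)
  next
    case 2
    have "(flat_exp k has_real_derivative 0) (at t)"
      by (rule has_field_derivative_transform_within_open[OF DERIV_const, where S = "{..<0}"])
        (use 2 in \<open>auto simp: flat_exp_def\<close>)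
    then show ?thesis
      using 2 by (simp add: flat_exp_def)
  next
    case 3
    \<comment> \<open>The difference quotient of \<open>flat_exp k\<close> at 0 is
      \<open>flat_exp (k + 1)\<close>, whose limit is already known to be 0.\<close>
    have "flat_exp (k + 1) = (\<lambda>t. flat_exp k t / t)"
      by (auto simp: flat_exp_def)
    with flat_exp_tendsto_0[of "k + 1"] show ?thesis
      by (simp add: 3 DERIV_def flat_exp_def[of _ 0])
  qed
qed

lemma smooth_on_flat_exp: "smooth_on UNIV (flat_exp k)"
proof -
  have "Ck_on n UNIV (flat_exp k)" for n k
  proof (induction n arbitrary: k)
    case 0
    then show ?case
      using DERIV_isCont[OF flat_exp_has_derivative[of k]] by (simp add: continuous_at_imp_continuous_on)
  next
    case (Suc n)
    show ?case
    proof (rule Ck_on_SucI)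
      show "(flat_exp k has_derivative (\<lambda>v. (flat_exp (k + 2) t + (- real k) * flat_exp (k + 1) t) * v)) (at t)" for t
        using flat_exp_has_derivative[of k t] by (simp add: has_field_derivative_def)
      show "Ck_on n UNIV (\<lambda>t. (flat_exp (k + 2) t + (- real k) * flat_exp (k + 1) t) * v)" for v
        by (intro Ck_on_add Ck_on_bounded_bilinear[OF _ bounded_bilinear_mult] Ck_on_const Suc.IH open_UNIV)
    qed simp
  qed
  then show ?thesis
    unfolding smooth_on_def by blast
qed

text \<open>The compact set \<open>C\<close> matters on a manifold: its preimage under a chart is
  compact, hence closed in a Hausdorff space, which makes extension by zero smooth.\<close>

lemma smooth_bump:
  fixes x\<^sub>0 :: "'v::euclidean_space"
  assumes "open U" "x\<^sub>0 \<in> U"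
  obtains \<eta> :: "'v \<Rightarrow> real" and C where "smooth_on UNIV \<eta>" "\<eta> x\<^sub>0 = 1" "compact C" "C \<subseteq> U"
    "\<And>x. x \<notin> C \<Longrightarrow> \<eta> x = 0"
proof -
  obtain e where e: "e > 0" "cball x\<^sub>0 e \<subseteq> U"
    using assms open_contains_cball by blast
  \<comment> \<open>The argument of the flat function is positive exactly inside the ball of radius
    e; dividing by the value at the centre normalizes.\<close>
  define \<eta> where "\<eta> x = flat_exp 0 (e\<^sup>2 + - ((x + - x\<^sub>0) \<bullet> (x + - x\<^sub>0))) * inverse (flat_exp 0 (e\<^sup>2))" for x
  have "smooth_on UNIV (\<lambda>x. e\<^sup>2 + - ((x + - x\<^sub>0) \<bullet> (x + - x\<^sub>0)))"
    by (intro smooth_on_add smooth_on_minus smooth_on_const smooth_on_id open_UNIV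
        smooth_on_bounded_bilinear[OF _ bounded_bilinear_inner])
  then have "smooth_on UNIV \<eta>"
    unfolding \<eta>_def
    by (intro smooth_on_mult smooth_on_const smooth_on_compose[OF _ open_UNIV _ _ smooth_on_flat_exp]) auto
  moreover have "\<eta> x\<^sub>0 = 1"
    using e by (simp add: \<eta>_def flat_exp_def)
  moreover have "\<eta> x = 0" if "x \<notin> cball x\<^sub>0 e" for x
  proof -
    have "e\<^sup>2 \<le> (norm (x - x\<^sub>0))\<^sup>2"
      using that e by (intro power_mono) (auto simp: dist_norm norm_minus_commute)
    then show ?thesis
      by (simp add: \<eta>_def flat_exp_def power2_norm_eq_inner)
  qed
  ultimately show thesis
    using that[of \<eta> "cball x\<^sub>0 e"] e by auto
qed

section \<open>Total differential equations and the local Frobenius theorem\<close>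

text \<open>At a point s where |e| is maximal the mean value inequality gives |e(s)| \<le> c +
  |e(s)|/2, and the last term is absorbed on the left. The constant 1/2 on a unit interval replaces
  the exponential of the usual Gronwall bound.\<close>

lemma half_gronwall:
  fixes e :: "real \<Rightarrow> 'x::euclidean_space"
  assumes deriv: "\<And>t. t \<in> {0..1} \<Longrightarrow> (e has_vector_derivative e' t) (at t within {0..1})"
    and "e 0 = 0" and bound: "\<And>t. t \<in> {0..1} \<Longrightarrow> norm (e' t) \<le> c + norm (e t) / 2"
    and "t \<in> {0..1}"
  shows "norm (e t) \<le> 2 * c"
proof -
  have "continuous_on {0..1} e"
    using deriv has_vector_derivative_continuous continuous_on_eq_continuous_within by blast
  then obtain s where s: "s \<in> {0..1}" "\<And>t. t \<in> {0..1} \<Longrightarrow> norm (e t) \<le> norm (e s)"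
    using continuous_attains_sup[of "{0..1}" "\<lambda>t. norm (e t)"] continuous_on_norm by fastforce
  have "norm (e s - e 0) \<le> (c + norm (e s) / 2) * norm (s - 0)"
  proof (rule differentiable_bound[where f' = "\<lambda>t h. h *\<^sub>R e' t" and S = "{0..1}"])
    show "onorm (\<lambda>h. h *\<^sub>R e' t) \<le> c + norm (e s) / 2" if "t \<in> {0..1}" for t
    proof (rule onorm_le)
      fix h :: real
      have "norm (e' t) \<le> c + norm (e s) / 2"
        using bound[OF that] s(2)[OF that] by linarith
      then have "norm (e' t) * \<bar>h\<bar> \<le> (c + norm (e s) / 2) * \<bar>h\<bar>"
        by (rule mult_right_mono) simp
      then show "norm (h *\<^sub>R e' t) \<le> (c + norm (e s) / 2) * norm h"
        by (simp add: mult.commute)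
    qed
  qed (use s deriv in \<open>auto simp: has_vector_derivative_def\<close>)
  also have "\<dots> \<le> (c + norm (e s) / 2) * 1"
  proof (rule mult_left_mono)
    show "0 \<le> c + norm (e s) / 2"
      using order_trans[OF norm_ge_zero bound[OF s(1)]] .
  qed (use s(1) in auto)
  finally show ?thesis
    using s(2)[OF assms(4)] assms(2) by simp
qed

text \<open>Picard iteration on all of [0,1]: the bound R on the field keeps curves in the ball over
  unit time, and the Lipschitz constant 1/2 makes the integral operator a contraction.\<close>

lemma autonomous_ode_exists:
  fixes f :: "'x::euclidean_space \<Rightarrow> 'x"
  assumes "R \<ge> 0"
    and bound: "\<And>x. x \<in> cball x\<^sub>0 R \<Longrightarrow> norm (f x) \<le> R"
    and lip: "\<And>x x'. x \<in> cball x\<^sub>0 R \<Longrightarrow> x' \<in> cball x\<^sub>0 R \<Longrightarrow> norm (f x' - f x) \<le> norm (x' - x) / 2"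
  obtains g where "g 0 = x\<^sub>0" "\<And>t. t \<in> {0..1} \<Longrightarrow> g t \<in> cball x\<^sub>0 R"
    "\<And>t. t \<in> {0..1} \<Longrightarrow> (g has_vector_derivative f (g t)) (at t within {0..1::real})"
proof -
  have contf: "continuous_on (cball x\<^sub>0 R) f"
  proof (rule continuous_onI)
    show "\<exists>d>0. \<forall>x'\<in>cball x\<^sub>0 R. dist x' x < d \<longrightarrow> dist (f x') (f x) \<le> e"
      if "x \<in> cball x\<^sub>0 R" "e > 0" for x e
      using lip[OF that(1)] that by (intro exI[of _ e]) (force simp: dist_norm)
  qed
  define T where "T = (PiC UNIV (\<lambda>_. cball x\<^sub>0 R) :: (real \<Rightarrow>\<^sub>C 'x) set)"
  \<comment> \<open>Clamping time to [0,1] turns curves into bounded continuous functions on the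
    whole line, a complete space for the uniform distance.\<close>
  define c where "c t = max 0 (min 1 t)" for t :: real
  have c: "c t \<in> {0..1}" for t
    by (auto simp: c_def)
  define \<Phi> where "\<Phi> g t = x\<^sub>0 + integral {0..c t} (\<lambda>s. f (apply_bcontfun g s))" for g t
  have contg: "continuous_on S (\<lambda>s. f (apply_bcontfun g s))" if "g \<in> T" for g S
    using that by (intro continuous_on_compose2[OF contf]) (auto simp: T_def mem_PiC_iff)
  have integrable: "(\<lambda>s. f (apply_bcontfun g s)) integrable_on {a..b}" if "g \<in> T" for g a b
    using contg[OF that] by (rule integrable_continuous_real)
  have \<Phi>_ball: "\<Phi> g t \<in> cball x\<^sub>0 R" if "g \<in> T" for g t
  proof -
    have "norm (integral {0..c t} (\<lambda>s. f (apply_bcontfun g s))) \<le> R * (c t - 0)"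
      using that c[of t] by (intro integral_bound contg bound) (auto simp: T_def mem_PiC_iff)
    also have "\<dots> \<le> R * 1"
      using assms(1) c[of t] by (intro mult_left_mono) auto
    finally show ?thesis
      by (simp add: \<Phi>_def dist_norm)
  qed
  have \<Phi>_cont: "\<Phi> g \<in> bcontfun" if "g \<in> T" for g
  proof -
    have "continuous_on UNIV (\<lambda>t. integral {0..c t} (\<lambda>s. f (apply_bcontfun g s)))"
      using c by (intro continuous_on_compose2[OF indefinite_integral_continuous_1[OF integrable[OF that, of 0 1]]])
        (auto simp: c_def intro!: continuous_intros)
    then have "continuous_on UNIV (\<Phi> g)"
      unfolding \<Phi>_def by (intro continuous_intros)
    moreover have "range (\<Phi> g) \<subseteq> cball x\<^sub>0 R"
      using \<Phi>_ball[OF that] by blast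
    ultimately show ?thesis
      using bounded_subset[OF bounded_cball] by (auto simp: bcontfun_def)
  qed
  have \<Phi>_apply: "apply_bcontfun (Bcontfun (\<Phi> g)) = \<Phi> g" if "g \<in> T" for g
    using \<Phi>_cont[OF that] by (rule Bcontfun_inverse)
  have "\<exists>!g. g \<in> T \<and> Bcontfun (\<Phi> g) = g"
  proof (rule Banach_fix)
    show "complete T"
      unfolding T_def complete_eq_closed by (intro closed_PiC) simp
    show "T \<noteq> {}"
    proof -
      have "const_bcontfun x\<^sub>0 \<in> T"
        using assms(1) by (auto simp: T_def mem_PiC_iff const_bcontfun.rep_eq)
      then show ?thesis by blast
    qed
    show "(\<lambda>g. Bcontfun (\<Phi> g)) ` T \<subseteq> T"
    proof safe
      fix g assume "g \<in> T"
      then show "Bcontfun (\<Phi> g) \<in> T"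
        using \<Phi>_ball by (simp add: T_def mem_PiC_iff \<Phi>_apply[unfolded T_def])
    qed
    show "dist (Bcontfun (\<Phi> g)) (Bcontfun (\<Phi> h)) \<le> 1 / 2 * dist g h" if gh: "g \<in> T" "h \<in> T" for g h
    proof (rule dist_bound)
      fix t
      have "norm (integral {0..c t} (\<lambda>s. f (apply_bcontfun g s) - f (apply_bcontfun h s))) \<le> dist g h / 2 * (c t - 0)"
      proof (rule integral_bound)
        show "norm (f (apply_bcontfun g s) - f (apply_bcontfun h s)) \<le> dist g h / 2" for s
          using lip[of "apply_bcontfun h s" "apply_bcontfun g s"] gh dist_bounded[of g s h]
          by (auto simp: T_def mem_PiC_iff dist_norm Pi_iff)
      qed (use c[of t] gh contg in \<open>auto intro!: continuous_intros\<close>)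
      also have "\<dots> \<le> dist g h / 2 * 1"
        using c[of t] by (intro mult_left_mono) auto
      finally show "dist (apply_bcontfun (Bcontfun (\<Phi> g)) t) (apply_bcontfun (Bcontfun (\<Phi> h)) t) \<le> 1/2 * dist g h"
        using integral_diff[OF integrable[OF gh(1), of 0 "c t"] integrable[OF gh(2), of 0 "c t"]]
        by (simp add: \<Phi>_apply gh \<Phi>_def dist_norm)
    qed
  qed simp_all
  then obtain g where g: "g \<in> T" "Bcontfun (\<Phi> g) = g"
    by (elim ex1E conjE)
  have fix_eq: "apply_bcontfun g t = x\<^sub>0 + integral {0..t} (\<lambda>s. f (apply_bcontfun g s))" if "t \<in> {0..1}" for t
  proof -
    have "apply_bcontfun g t = \<Phi> g t"
      by (rule fun_cong[OF \<Phi>_apply[OF g(1), unfolded g(2)]])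
    also have "\<dots> = x\<^sub>0 + integral {0..t} (\<lambda>s. f (apply_bcontfun g s))"
      using that by (simp add: \<Phi>_def c_def)
    finally show ?thesis .
  qed
  show thesis
  proof (rule that[of "apply_bcontfun g"])
    fix t :: real assume t: "t \<in> {0..1}"
    show "apply_bcontfun g t \<in> cball x\<^sub>0 R"
      using g(1) by (auto simp: T_def mem_PiC_iff)
    have "((\<lambda>t. integral {0..t} (\<lambda>s. f (apply_bcontfun g s))) has_vector_derivative f (apply_bcontfun g t))
        (at t within {0..1})"
      by (rule integral_has_vector_derivative[OF contg[OF g(1)] t])
    then have "((\<lambda>t. x\<^sub>0 + integral {0..t} (\<lambda>s. f (apply_bcontfun g s))) has_vector_derivative f (apply_bcontfun g t))
        (at t within {0..1})"
      by (auto intro!: derivative_eq_intros)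
    then show "(apply_bcontfun g has_vector_derivative f (apply_bcontfun g t)) (at t within {0..1})"
      by (rule has_vector_derivative_transform[OF t, rotated]) (use fix_eq in auto)
  qed (use fix_eq[of 0] in auto)
qed

text \<open>Compactness bounds the first and second derivatives, convexity integrates these bounds
  along segments, and one common constant serves all three estimates.\<close>

lemma smooth_on_taylor_bounds:
  fixes f :: "'v::euclidean_space \<Rightarrow> 'w::real_normed_vector"
  assumes "open W" "smooth_on W f" "compact C" "convex C" "C \<subseteq> W"
  obtains L where "L \<ge> 0"
    "\<And>x v. x \<in> C \<Longrightarrow> norm (frechet_derivative f (at x) v) \<le> L * norm v"
    "\<And>x x'. x \<in> C \<Longrightarrow> x' \<in> C \<Longrightarrow> norm (f x' - f x) \<le> L * norm (x' - x)"
    "\<And>x x'. x \<in> C \<Longrightarrow> x' \<in> C \<Longrightarrow>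
      norm (f x' - f x - frechet_derivative f (at x) (x' - x)) \<le> L * (norm (x' - x))\<^sup>2"
proof -
  have D: "\<exists>L\<ge>0. \<forall>x\<in>C. \<forall>v. norm (frechet_derivative h (at x) v) \<le> L * norm v"
    if "smooth_on W h" for h :: "'v \<Rightarrow> 'w"
  proof -
    have "\<exists>B. \<forall>x\<in>C. norm (frechet_derivative h (at x) b) \<le> B" for b
    proof -
      have "continuous_on C (\<lambda>x. frechet_derivative h (at x) b)"
        using smooth_on_continuous_on[OF smooth_on_frechet_derivative[OF that]] assms(5)
        by (rule continuous_on_subset)
      then have "bounded ((\<lambda>x. frechet_derivative h (at x) b) ` C)"
        using assms(3) compact_continuous_image compact_imp_bounded by blast
      then show ?thesis
        by (auto simp: bounded_iff)
    qed
    then obtain B where B: "\<And>b x. x \<in> C \<Longrightarrow> norm (frechet_derivative h (at x) b) \<le> B b"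
      by metis
    show ?thesis
    \<comment> \<open>Summing over the basis bounds the derivative in all directions at once;
      \<open>max 0\<close> keeps the constant nonnegative even when C is empty.\<close>
    proof (intro exI[of _ "\<Sum>b\<in>Basis. max 0 (B b)"] conjI ballI allI)
      fix x v assume x: "x \<in> C"
      have "linear (frechet_derivative h (at x))"
        using has_derivative_linear[OF smooth_on_has_derivative[OF that]] x assms(5) by blast
      then have "frechet_derivative h (at x) v = (\<Sum>b\<in>Basis. (v \<bullet> b) *\<^sub>R frechet_derivative h (at x) b)"
        by (rule linear_Basis_expansion)
      also have "norm \<dots> \<le> (\<Sum>b\<in>Basis. max 0 (B b) * norm v)"
      proof (rule sum_norm_le)
        fix b :: 'v assume "b \<in> Basis"
        then show "norm ((v \<bullet> b) *\<^sub>R frechet_derivative h (at x) b) \<le> max 0 (B b) * norm v"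
          using B[OF x, of b] Basis_le_norm[of b v]
          by (subst mult.commute) (auto intro!: mult_mono)
      qed
      finally show "norm (frechet_derivative h (at x) v) \<le> (\<Sum>b\<in>Basis. max 0 (B b)) * norm v"
        by (simp add: sum_distrib_right)
    qed (simp add: sum_nonneg)
  qed
  have Lip: "norm (h x' - h x) \<le> L * norm (x' - x)"
    if "smooth_on W h" "\<And>x v. x \<in> C \<Longrightarrow> norm (frechet_derivative h (at x) v) \<le> L * norm v" "x \<in> C" "x' \<in> C"
    for h :: "'v \<Rightarrow> 'w" and x x' L
    by (rule differentiable_bound[OF assms(4) _ onorm_le])
      (use that has_derivative_at_withinI[OF smooth_on_has_derivative[OF that(1) subsetD[OF assms(5)]]] in auto)
  obtain L1 where L1: "L1 \<ge> 0" "\<And>x v. x \<in> C \<Longrightarrow> norm (frechet_derivative f (at x) v) \<le> L1 * norm v"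
    using D[OF assms(2)] by blast
  have "\<exists>L\<ge>0. \<forall>x\<in>C. \<forall>v. norm (frechet_derivative (\<lambda>x. frechet_derivative f (at x) b) (at x) v) \<le> L * norm v" for b
    by (rule D[OF smooth_on_frechet_derivative[OF assms(2)]])
  then obtain L2 where L2: "\<And>b. L2 b \<ge> 0" "\<And>b x v. x \<in> C \<Longrightarrow>
      norm (frechet_derivative (\<lambda>x. frechet_derivative f (at x) b) (at x) v) \<le> L2 b * norm v"
    by metis
  \<comment> \<open>A Lipschitz constant for x \<mapsto> Df(x) in operator norm, obtained from the
    second derivatives in the basis directions.\<close>
  define Q where "Q = (\<Sum>b\<in>Basis. L2 b)"
  have Q: "norm (frechet_derivative f (at x') v - frechet_derivative f (at x) v) \<le> Q * norm (x' - x) * norm v"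
    if "x \<in> C" "x' \<in> C" for x x' v
  proof -
    have lin: "linear (\<lambda>v. frechet_derivative f (at x') v - frechet_derivative f (at x) v)"
      using that assms(5) smooth_on_has_derivative[OF assms(2)]
      by (intro linear_compose_sub has_derivative_linear) blast+
    have "frechet_derivative f (at x') v - frechet_derivative f (at x) v =
        (\<Sum>b\<in>Basis. (v \<bullet> b) *\<^sub>R (frechet_derivative f (at x') b - frechet_derivative f (at x) b))"
      by (rule linear_Basis_expansion[OF lin])
    also have "norm \<dots> \<le> (\<Sum>b\<in>Basis. L2 b * norm (x' - x) * norm v)"
    proof (rule sum_norm_le)
      fix b :: 'v assume "b \<in> Basis"
      then show "norm ((v \<bullet> b) *\<^sub>R (frechet_derivative f (at x') b - frechet_derivative f (at x) b))
          \<le> L2 b * norm (x' - x) * norm v"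
        using Lip[OF smooth_on_frechet_derivative[OF assms(2), of b] L2(2)[of _ b] that] Basis_le_norm[of b v] L2(1)[of b]
        by (subst mult.commute) (auto intro!: mult_mono)
    qed
    finally show ?thesis
      by (simp add: Q_def sum_distrib_right)
  qed
  have "Q \<ge> 0"
    using L2(1) by (simp add: Q_def sum_nonneg)
  show thesis
  proof (rule that[of "max L1 Q"])
    fix x x' assume x: "x \<in> C" "x' \<in> C"
    have le: "L1 * norm v \<le> max L1 Q * norm v" for v :: 'v
      by (intro mult_right_mono) auto
    show "norm (frechet_derivative f (at x) v) \<le> max L1 Q * norm v" for v
      using L1(2)[OF x(1)] le order_trans by blast
    show "norm (f x' - f x) \<le> max L1 Q * norm (x' - x)"
      using Lip[OF assms(2) L1(2) x] le order_trans by blast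
    have seg: "closed_segment x x' \<subseteq> C"
      using x assms(4) by (simp add: closed_segment_subset)
    have "norm (f x' - f x - frechet_derivative f (at x) (x' - x)) \<le> norm (x' - x) * (Q * norm (x' - x))"
    proof (rule differentiable_bound_linearization[where S = "closed_segment x x'" and f' = "\<lambda>z. frechet_derivative f (at z)"])
      show "x + t *\<^sub>R (x' - x) \<in> closed_segment x x'" if "t \<in> {0..1}" for t
        using that by (auto simp: in_segment algebra_simps intro!: exI[of _ t])
      fix z assume z: "z \<in> closed_segment x x'"
      then show "(f has_derivative frechet_derivative f (at z)) (at z within closed_segment x x')"
        using seg assms(5) smooth_on_has_derivative[OF assms(2)] has_derivative_at_withinI by blast
      show "onorm (frechet_derivative f (at z) - frechet_derivative f (at x)) \<le> Q * norm (x' - x)"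
        unfolding fun_diff_def
      proof (rule onorm_le)
        fix v :: 'v
        have "norm (z - x) \<le> norm (x' - x)"
          using z by (metis dist_commute dist_norm segment_bound(1) norm_minus_commute)
        then have "Q * norm (z - x) * norm v \<le> Q * norm (x' - x) * norm v"
          using \<open>Q \<ge> 0\<close> by (intro mult_right_mono mult_left_mono) auto
        then show "norm (frechet_derivative f (at z) v - frechet_derivative f (at x) v) \<le> Q * norm (x' - x) * norm v"
          using Q[OF x(1), of z v] z seg by fastforce
      qed
    qed auto
    also have "\<dots> \<le> max L1 Q * (norm (x' - x))\<^sup>2"
      by (simp add: power2_eq_square mult_right_mono mult.left_commute)
    finally show "norm (f x' - f x - frechet_derivative f (at x) (x' - x)) \<le> max L1 Q * (norm (x' - x))\<^sup>2" .
  qed (use L1(1) in auto)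
qed


lemma bounded_bilinear_matrix_vector_mult:
  "bounded_bilinear ((*v) :: real ^ 'n::finite ^ 'm::finite \<Rightarrow> real ^ 'n \<Rightarrow> real ^ 'm)"
  by (rule bilinear_conv_bounded_bilinear[THEN iffD1])
    (auto simp: bilinear_def matrix_vector_right_distrib matrix_vector_mult_add_rdistrib
      scaleR_matrix_vector_assoc matrix_vector_mult_scaleR intro!: linearI)

text \<open>The solution at \<open>y\<close> is the time-one value of the curve \<open>g\<close> with \<open>g' = B(g) y\<close>.
  The commutation hypothesis makes the defect \<open>h - g - t B(g) (y' - y)\<close> of two such curves satisfy
  a linear differential inequality with a quadratically small right-hand side.\<close>

lemma total_differential_equation:
  fixes B :: "real ^ 'n::finite \<Rightarrow> real ^ 'r::finite ^ 'n"
  assumes W: "open W" "x\<^sub>0 \<in> W" and smooth: "smooth_on W B"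
    and comm: "\<And>x a b. x \<in> W \<Longrightarrow>
      frechet_derivative B (at x) (B x *v a) *v b = frechet_derivative B (at x) (B x *v b) *v a"
  obtains \<rho> \<phi> where "\<rho> > 0" "\<phi> 0 = x\<^sub>0" "\<phi> ` ball 0 \<rho> \<subseteq> W"
    "\<And>y. y \<in> ball 0 \<rho> \<Longrightarrow> (\<phi> has_derivative (\<lambda>a. B (\<phi> y) *v a)) (at y)"
proof -
  let ?D = "\<lambda>x. frechet_derivative B (at x)"
  obtain R where R: "R > 0" "cball x\<^sub>0 R \<subseteq> W"
    using W open_contains_cball by blast
  let ?C = "cball x\<^sub>0 R"
  obtain L where L: "L \<ge> 0"
    "\<And>x v. x \<in> ?C \<Longrightarrow> norm (?D x v) \<le> L * norm v"
    "\<And>x x'. x \<in> ?C \<Longrightarrow> x' \<in> ?C \<Longrightarrow> norm (B x' - B x) \<le> L * norm (x' - x)"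
    "\<And>x x'. x \<in> ?C \<Longrightarrow> x' \<in> ?C \<Longrightarrow> norm (B x' - B x - ?D x (x' - x)) \<le> L * (norm (x' - x))\<^sup>2"
    using smooth_on_taylor_bounds[OF W(1) smooth compact_cball convex_cball R(2)] by blast
  obtain K where K: "K > 0" "\<And>(T :: real ^ 'r ^ 'n) a. norm (T *v a) \<le> norm T * norm a * K"
    using bounded_bilinear.pos_bounded[OF bounded_bilinear_matrix_vector_mult] by blast
  obtain M where M: "M > 0" "\<And>x. x \<in> ?C \<Longrightarrow> norm (B x) \<le> M"
    using compact_imp_bounded[OF compact_continuous_image[OF
          continuous_on_subset[OF smooth_on_continuous_on[OF smooth] R(2)] compact_cball]]
    by (auto simp: bounded_pos)
  have mv: "norm (T *v a) \<le> t * norm a * K" if "norm T \<le> t" for T :: "real ^ 'r ^ 'n" and a t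
    using order_trans[OF K(2) mult_right_mono[OF mult_right_mono[OF that norm_ge_zero] less_imp_le[OF K(1)]]] .
  \<comment> \<open>For |y| \<le> \<rho> the first bound keeps the field x \<mapsto> B(x) y below R
    in norm, and the second makes it Lipschitz with constant 1/2. Writing L + 1 avoids dividing by 0
    when L = 0.\<close>
  define \<rho> where "\<rho> = min (R / (M * K)) (1 / (2 * (L + 1) * K))"
  have \<rho>: "\<rho> > 0" "M * \<rho> * K \<le> R" "L * \<rho> * K \<le> 1 / 2"
  proof -
    show "\<rho> > 0"
      using R M K L(1) by (simp add: \<rho>_def)
    have "\<rho> \<le> R / (M * K)"
      by (simp add: \<rho>_def)
    then show "M * \<rho> * K \<le> R"
      using M K by (simp add: field_simps)
    have "\<rho> \<le> 1 / (2 * (L + 1) * K)"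
      by (simp add: \<rho>_def)
    then have "\<rho> * (2 * (L + 1) * K) \<le> 1"
      using L(1) K by (subst (asm) pos_le_divide_eq) auto
    then have "(L + 1) * \<rho> * K \<le> 1 / 2"
      by (simp add: mult_ac)
    moreover have "L * \<rho> * K \<le> (L + 1) * \<rho> * K"
      using \<open>\<rho> > 0\<close> K by (intro mult_right_mono) auto
    ultimately show "L * \<rho> * K \<le> 1 / 2" by linarith
  qed
  have lip: "norm ((B x' - B x) *v y) \<le> norm (x' - x) / 2"
    if "x \<in> ?C" "x' \<in> ?C" "norm y \<le> \<rho>" for x x' y
  proof -
    have "norm ((B x' - B x) *v y) \<le> L * norm (x' - x) * norm y * K"
      using L(3)[OF that(1,2)] by (rule mv)
    also have "\<dots> \<le> L * norm (x' - x) * \<rho> * K"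
      using L(1) K that(3) by (intro mult_right_mono mult_left_mono) auto
    also have "\<dots> = (L * \<rho> * K) * norm (x' - x)"
      by simp
    also have "\<dots> \<le> 1 / 2 * norm (x' - x)"
      using \<rho>(3) by (intro mult_right_mono) auto
    finally show ?thesis by simp
  qed
  have "\<exists>g. g 0 = x\<^sub>0 \<and> (\<forall>t\<in>{0..1}. g t \<in> ?C \<and>
      (g has_vector_derivative B (g t) *v y) (at t within {0..1::real}))" if y: "norm y \<le> \<rho>" for y
  proof (rule autonomous_ode_exists[where R = R and x\<^sub>0 = x\<^sub>0 and f = "\<lambda>x. B x *v y"])
    fix x assume x: "x \<in> ?C"
    have "norm (B x *v y) \<le> M * norm y * K"
      using M(2)[OF x] by (rule mv)
    also have "\<dots> \<le> M * \<rho> * K"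
      using M K y by (intro mult_right_mono mult_left_mono) auto
    also have "\<dots> \<le> R" by (rule \<rho>(2))
    finally show "norm (B x *v y) \<le> R" .
  next
    show "norm (B x' *v y - B x *v y) \<le> norm (x' - x) / 2" if "x \<in> ?C" "x' \<in> ?C" for x x'
      using lip[OF that y] by (simp add: matrix_vector_mult_diff_rdistrib)
  qed (use R in auto)
  then obtain g where g: "\<And>y. norm y \<le> \<rho> \<Longrightarrow> g y 0 = x\<^sub>0"
    "\<And>y t. norm y \<le> \<rho> \<Longrightarrow> t \<in> {0..1::real} \<Longrightarrow> g y t \<in> ?C"
    "\<And>y t. norm y \<le> \<rho> \<Longrightarrow> t \<in> {0..1} \<Longrightarrow> (g y has_vector_derivative B (g y t) *v y) (at t within {0..1})"
    by metis
  have g_lip: "norm (g y' t - g y t) \<le> 2 * (M * norm (y' - y) * K)"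
    if y: "norm y \<le> \<rho>" "norm y' \<le> \<rho>" and t: "t \<in> {0..1}" for y y' t
  proof (rule half_gronwall[where e = "\<lambda>t. g y' t - g y t" and e' = "\<lambda>t. B (g y' t) *v y' - B (g y t) *v y"])
    fix t :: real assume t: "t \<in> {0..1}"
    show "((\<lambda>t. g y' t - g y t) has_vector_derivative B (g y' t) *v y' - B (g y t) *v y) (at t within {0..1})"
      using g(3) y t by (intro has_vector_derivative_diff) auto
    have "B (g y' t) *v y' - B (g y t) *v y = B (g y' t) *v (y' - y) + (B (g y' t) - B (g y t)) *v y"
      by (simp add: matrix_vector_mult_diff_rdistrib matrix_vector_mult_diff_distrib)
    also have "norm \<dots> \<le> M * norm (y' - y) * K + norm (g y' t - g y t) / 2"
      using g(2) y t by (intro norm_triangle_mono mv M(2) lip) auto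
    finally show "norm (B (g y' t) *v y' - B (g y t) *v y) \<le> M * norm (y' - y) * K + norm (g y' t - g y t) / 2" .
  qed (use g(1) y t in auto)
  \<comment> \<open>The two quadratic errors in e': the Taylor remainder of B applied to y, and the
    increment of B applied to y' - y. Both use |g y' t - g y t| \<le> 2 M K |y' - y| from
    \<open>g_lip\<close>.\<close>
  define c where "c = L * (2 * (M * K))\<^sup>2 * \<rho> * K + L * (2 * (M * K)) * K"
  have g_taylor: "norm (g y' t - g y t - t *\<^sub>R (B (g y t) *v (y' - y))) \<le> 2 * (c * (norm (y' - y))\<^sup>2)"
    if y: "norm y \<le> \<rho>" "norm y' \<le> \<rho>" and t: "t \<in> {0..1}" for y y' t
  proof -
    define \<delta> where "\<delta> = y' - y"
    define e where "e t = g y' t - g y t - t *\<^sub>R (B (g y t) *v \<delta>)" for t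
    define e' where "e' t = (B (g y' t) - B (g y t) - ?D (g y t) (g y' t - g y t)) *v y
      + (B (g y' t) - B (g y t)) *v \<delta> + ?D (g y t) (e t) *v y" for t
    have "norm (e t) \<le> 2 * (c * (norm \<delta>)\<^sup>2)"
    proof (rule half_gronwall[where e' = e'])
      fix t :: real assume t: "t \<in> {0..1}"
      let ?g = "g y t" and ?h = "g y' t"
      have gW: "?g \<in> ?C" "?h \<in> ?C"
        using g(2) y t by auto
      then have dB: "(B has_derivative ?D ?g) (at ?g)"
        using smooth_on_has_derivative[OF smooth] R(2) by blast
      interpret D: linear "?D ?g"
        using dB by (rule has_derivative_linear)
      have "((\<lambda>t. B (g y t)) has_vector_derivative ?D ?g (B ?g *v y)) (at t within {0..1})"
        using has_derivative_compose[OF g(3)[OF y(1) t, unfolded has_vector_derivative_def] dB]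
        by (simp add: has_vector_derivative_def D.scale)
      then have "((\<lambda>t. B (g y t) *v \<delta>) has_vector_derivative ?D ?g (B ?g *v y) *v \<delta>) (at t within {0..1})"
        by (rule bounded_linear.has_vector_derivative[OF
            bounded_bilinear.bounded_linear_left[OF bounded_bilinear_matrix_vector_mult]])
      then have "((\<lambda>t. t *\<^sub>R (B (g y t) *v \<delta>)) has_vector_derivative
          t *\<^sub>R (?D ?g (B ?g *v y) *v \<delta>) + B ?g *v \<delta>) (at t within {0..1})"
        by (auto intro!: derivative_eq_intros)
      then have "(e has_vector_derivative
          B ?h *v y' - B ?g *v y - (t *\<^sub>R (?D ?g (B ?g *v y) *v \<delta>) + B ?g *v \<delta>)) (at t within {0..1})"
        unfolding e_def[abs_def] using g(3) y t by (intro has_vector_derivative_diff) auto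
      moreover have "B ?h *v y' - B ?g *v y - (t *\<^sub>R (?D ?g (B ?g *v y) *v \<delta>) + B ?g *v \<delta>) = e' t"
      proof -
        \<comment> \<open>The decisive use of commutation: with y and \<delta> exchanged, this term
          joins DB(h - g) y to form DB(e) y, which is linear in the defect e and small enough for
          \<open>half_gronwall\<close>.\<close>
        have "?D ?g (B ?g *v y) *v \<delta> = ?D ?g (B ?g *v \<delta>) *v y"
          using comm gW(1) R(2) by blast
        moreover have "?D ?g (e t) = ?D ?g (?h - ?g) - t *\<^sub>R ?D ?g (B ?g *v \<delta>)"
          by (simp add: e_def D.diff D.scale)
        moreover have "y' = y + \<delta>"
          by (simp add: \<delta>_def)
        ultimately show ?thesis
          by (simp add: e'_def matrix_vector_mult_diff_rdistrib matrix_vector_right_distrib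
              scaleR_matrix_vector_assoc)
      qed
      ultimately show "(e has_vector_derivative e' t) (at t within {0..1})"
        by simp
      have gh: "norm (?h - ?g) \<le> 2 * (M * K) * norm \<delta>"
        using g_lip[OF y t] by (simp add: \<delta>_def mult_ac)
      have "norm ((B ?h - B ?g - ?D ?g (?h - ?g)) *v y) \<le> L * (norm (?h - ?g))\<^sup>2 * norm y * K"
        using L(4)[OF gW] by (rule mv)
      also have "\<dots> \<le> L * (2 * (M * K) * norm \<delta>)\<^sup>2 * \<rho> * K"
        using gh L(1) K \<rho>(1) y by (intro mult_right_mono mult_mono power_mono) auto
      finally have 1: "norm ((B ?h - B ?g - ?D ?g (?h - ?g)) *v y) \<le> L * (2 * (M * K) * norm \<delta>)\<^sup>2 * \<rho> * K" .
      have "norm ((B ?h - B ?g) *v \<delta>) \<le> L * norm (?h - ?g) * norm \<delta> * K"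
        using L(3)[OF gW] by (rule mv)
      also have "\<dots> \<le> L * (2 * (M * K) * norm \<delta>) * norm \<delta> * K"
        using gh L(1) K by (intro mult_right_mono mult_left_mono) auto
      finally have 2: "norm ((B ?h - B ?g) *v \<delta>) \<le> L * (2 * (M * K) * norm \<delta>) * norm \<delta> * K" .
      have "norm (?D ?g (e t) *v y) \<le> L * norm (e t) * norm y * K"
        using L(2)[OF gW(1)] by (rule mv)
      also have "\<dots> \<le> L * norm (e t) * \<rho> * K"
        using L(1) K y by (intro mult_right_mono mult_left_mono) auto
      also have "\<dots> = (L * \<rho> * K) * norm (e t)"
        by simp
      also have "\<dots> \<le> 1 / 2 * norm (e t)"
        using \<rho>(3) by (intro mult_right_mono) auto
      finally have 3: "norm (?D ?g (e t) *v y) \<le> norm (e t) / 2"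
        by simp
      have "norm (e' t) \<le> L * (2 * (M * K) * norm \<delta>)\<^sup>2 * \<rho> * K + L * (2 * (M * K) * norm \<delta>) * norm \<delta> * K
          + norm (e t) / 2"
        unfolding e'_def by (intro norm_triangle_mono 1 2 3)
      also have "\<dots> = c * (norm \<delta>)\<^sup>2 + norm (e t) / 2"
        by (simp add: c_def power2_eq_square algebra_simps)
      finally show "norm (e' t) \<le> c * (norm \<delta>)\<^sup>2 + norm (e t) / 2" .
    qed (use t g(1) y in \<open>auto simp: e_def\<close>)
    then show ?thesis
      by (simp add: e_def \<delta>_def)
  qed
  define \<phi> where "\<phi> y = g y 1" for y
  show thesis
  proof (rule that[of \<rho> \<phi>])
    \<comment> \<open>For y = 0 the field vanishes, so the estimate with c = 0 shows that the curve
      is constant.\<close>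
    have "norm (g 0 1 - x\<^sub>0) \<le> 2 * 0"
    proof (rule half_gronwall[where e = "\<lambda>t. g 0 t - x\<^sub>0" and e' = "\<lambda>_. 0"])
      show "((\<lambda>t. g 0 t - x\<^sub>0) has_vector_derivative 0) (at t within {0..1})" if "t \<in> {0..1}" for t
        using g(3)[of 0 t] that \<rho>(1) by (auto intro!: derivative_eq_intros)
    qed (use g(1)[of 0] \<rho>(1) in auto)
    then show "\<phi> 0 = x\<^sub>0"
      by (simp add: \<phi>_def)
    show "\<phi> ` ball 0 \<rho> \<subseteq> W"
      using g(2)[of _ 1] R(2) by (force simp: \<phi>_def)
    fix y :: "real ^ 'r" assume y: "y \<in> ball 0 \<rho>"
    show "(\<phi> has_derivative (\<lambda>a. B (\<phi> y) *v a)) (at y)"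
      unfolding has_derivative_at_alt
    proof (intro conjI allI impI)
      fix \<epsilon> :: real assume "\<epsilon> > 0"
      obtain d where d: "d > 0" "ball y d \<subseteq> ball 0 \<rho>"
        using y openE[OF open_ball] by blast
      define d' where "d' = min d (\<epsilon> / (2 * \<bar>c\<bar> + 1))"
      have "norm (\<phi> y' - \<phi> y - B (\<phi> y) *v (y' - y)) \<le> \<epsilon> * norm (y' - y)" if y': "norm (y' - y) < d'" for y'
      proof -
        have "y' \<in> ball 0 \<rho>"
          using y' d by (auto simp: d'_def dist_norm norm_minus_commute subset_eq)
        then have "norm (\<phi> y' - \<phi> y - B (\<phi> y) *v (y' - y)) \<le> 2 * (c * (norm (y' - y))\<^sup>2)"
          using g_taylor[of y y' 1] y by (simp add: \<phi>_def)
        also have "\<dots> \<le> (2 * \<bar>c\<bar> + 1) * norm (y' - y) * norm (y' - y)"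
          unfolding power2_eq_square mult.assoc[symmetric] by (intro mult_right_mono) auto
        also have "\<dots> \<le> \<epsilon> * norm (y' - y)"
        proof (rule mult_right_mono)
          have "norm (y' - y) \<le> \<epsilon> / (2 * \<bar>c\<bar> + 1)"
            using y' by (simp add: d'_def)
          then show "(2 * \<bar>c\<bar> + 1) * norm (y' - y) \<le> \<epsilon>"
            by (simp add: field_simps)
        qed simp
        finally show ?thesis .
      qed
      moreover have "d' > 0"
        using d \<open>\<epsilon> > 0\<close> by (simp add: d'_def)
      ultimately show "\<exists>d>0. \<forall>z. norm (z - y) < d \<longrightarrow>
          norm (\<phi> z - \<phi> y - B (\<phi> y) *v (z - y)) \<le> \<epsilon> * norm (z - y)"
        by blast
    qed simp
  qed (rule \<rho>(1))
qed


text \<open>Bootstrapping: if \<phi> is k times continuously differentiable, then so is B(\<phi>),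
  which is the derivative of \<phi>, and one order is gained.\<close>

lemma smooth_on_total_differential_solution:
  fixes B :: "real ^ 'n::finite \<Rightarrow> real ^ 'r::finite ^ 'n"
  assumes "open S" "open W" "smooth_on W B" "\<phi> ` S \<subseteq> W"
    "\<And>y. y \<in> S \<Longrightarrow> (\<phi> has_derivative (\<lambda>a. B (\<phi> y) *v a)) (at y)"
  shows "smooth_on S \<phi>"
proof -
  have "Ck_on k S \<phi>" for k
  proof (induction k)
    case 0
    then show ?case
      using has_derivative_continuous[OF assms(5)] by (simp add: continuous_at_imp_continuous_on)
  next
    case (Suc k)
    have "Ck_on k S (\<lambda>y. B (\<phi> y))"
      using assms(3) unfolding smooth_on_def by (intro Ck_on_compose[OF assms(1,2,4) Suc]) auto
    then show ?case
      by (intro Ck_on_SucI[OF assms(1,5)] Ck_on_bounded_linear[OF assms(1)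
            bounded_bilinear.bounded_linear_left[OF bounded_bilinear_matrix_vector_mult]])
  qed
  then show ?thesis
    unfolding smooth_on_def by blast
qed

text \<open>Differentiates an identity T U = V that holds near x. Applied to L B = B, to P B = 1 and
  to L(LZ) = LZ, it yields all relations between derivatives that the proof uses.\<close>

lemma has_derivative_matrix_vector_eq:
  fixes T :: "'v::euclidean_space \<Rightarrow> real ^ 'n::finite ^ 'm::finite"
  assumes "open W" "x \<in> W"
    and T: "(T has_derivative T') (at x)" and U: "(U has_derivative U') (at x)"
    and V: "(V has_derivative V') (at x)" and eq: "\<And>y. y \<in> W \<Longrightarrow> T y *v U y = V y"
  shows "T x *v U' v + T' v *v U x = V' v"
proof -
  have "((\<lambda>y. T y *v U y) has_derivative (\<lambda>v. T x *v U' v + T' v *v U x)) (at x)"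
    by (rule bounded_bilinear.FDERIV[OF bounded_bilinear_matrix_vector_mult T U])
  then have "(V has_derivative (\<lambda>v. T x *v U' v + T' v *v U x)) (at x)"
    using has_derivative_transform_within_open[OF _ assms(1,2)] eq by blast
  then show ?thesis
    using has_derivative_unique[OF V] by metis
qed

lemma has_derivative_matrix_vector_mult_const:
  fixes T :: "'v::euclidean_space \<Rightarrow> real ^ 'n::finite ^ 'm::finite"
  shows "(T has_derivative T') F \<Longrightarrow> ((\<lambda>y. T y *v b) has_derivative (\<lambda>v. T' v *v b)) F"
  by (rule bounded_linear.has_derivative[OF
        bounded_bilinear.bounded_linear_left[OF bounded_bilinear_matrix_vector_mult]])

text \<open>For a projection field \<open>L\<close>, involutivity of its image amounts to symmetry of \<open>DL\<close> on the
  image, which is the form of the hypothesis below. The frame \<open>B\<close> of the image that projects under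
  \<open>P\<close> to the standard basis then consists of commuting fields.\<close>

lemma local_frobenius:
  fixes L :: "real ^ 'n::finite \<Rightarrow> real ^ 'n ^ 'n"
  assumes W: "open W" "x\<^sub>0 \<in> W" and smooth: "smooth_on W L"
    and proj: "\<And>x. x \<in> W \<Longrightarrow> L x ** L x = L x"
    and rank: "\<And>x. x \<in> W \<Longrightarrow> rank (L x) = CARD('r::finite)"
    and inv: "\<And>x u w. x \<in> W \<Longrightarrow> L x *v u = u \<Longrightarrow> L x *v w = w \<Longrightarrow>
      frechet_derivative L (at x) u *v w = frechet_derivative L (at x) w *v u"
  obtains \<rho> \<phi> and P :: "real ^ 'n ^ 'r" where "\<rho> > 0" "\<phi> 0 = x\<^sub>0" "\<phi> ` ball 0 \<rho> \<subseteq> W"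
    "smooth_on (ball 0 \<rho>) \<phi>"
    "\<And>y. y \<in> ball 0 \<rho> \<Longrightarrow> inj (frechet_derivative \<phi> (at y))"
    "\<And>y. y \<in> ball 0 \<rho> \<Longrightarrow> range (frechet_derivative \<phi> (at y)) = range ((*v) (L (\<phi> y)))"
    "\<And>y. y \<in> ball 0 \<rho> \<Longrightarrow> P *v \<phi> y = y + P *v x\<^sub>0"
proof -
  have "dim (UNIV :: (real ^ 'r) set) = dim (range ((*v) (L x\<^sub>0)))"
    using rank[OF W(2)] by (simp add: rank_dim_range)
  then obtain f :: "real ^ 'r \<Rightarrow> real ^ 'n" where f: "linear f" "f ` UNIV = range ((*v) (L x\<^sub>0))" "inj f"
    using subspace_isomorphism[OF subspace_UNIV linear_subspace_image[OF matrix_vector_mul_linear subspace_UNIV]]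
    by blast
  \<comment> \<open>The columns of \<open>E\<close> form a basis of the image of L at the base
    point, and \<open>P\<close> is a left inverse of \<open>E\<close>.\<close>
  define E where "E = matrix f"
  have E: "(*v) E = f"
    using f(1) by (auto simp: E_def matrix_works)
  obtain P where P: "P ** E = mat 1"
    using f(3) E matrix_left_invertible_injective by metis
  have LE: "L x\<^sub>0 ** E = E"
  proof -
    have "L x\<^sub>0 *v (E *v a) = E *v a" for a
    proof -
      obtain b where "E *v a = L x\<^sub>0 *v b"
        using f(2) E by (metis UNIV_I image_iff)
      then show ?thesis
        using proj[OF W(2)] by (simp add: matrix_vector_mul_assoc)
    qed
    then show ?thesis
      by (simp add: matrix_eq matrix_vector_mul_assoc[symmetric])
  qed
  \<comment> \<open>\<open>G x\<close> is the matrix of \<open>P\<close> on the vectors L(x) E. It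
    is the identity at the base point, hence invertible nearby, and its inverse normalizes the frame
    \<open>B\<close> below to P B = 1.\<close>
  define G where "G x = P ** (L x ** E)" for x
  have smoothLE: "smooth_on W (\<lambda>x. L x ** E)"
    by (intro smooth_on_matrix_matrix_mult smooth_on_const smooth W)
  then have smoothG: "smooth_on W G"
    unfolding G_def by (rule smooth_on_matrix_matrix_mult[OF W(1) smooth_on_const[OF W(1)]])
  define V where "V = {x \<in> W. det (G x) \<noteq> 0}"
  have VW: "V \<subseteq> W"
    by (auto simp: V_def)
  have V: "open V"
  proof -
    have "open (W \<inter> (\<lambda>x. det (G x)) -` (- {0}))"
      using smooth_on_continuous_on[OF smooth_on_det[OF W(1) smoothG]] W(1)
      by (intro continuous_open_preimage) auto
    then show ?thesis
      by (rule back_subst) (auto simp: V_def)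
  qed
  have x0V: "x\<^sub>0 \<in> V"
    by (simp add: V_def W G_def LE P)
  define B where "B x = (L x ** E) ** matrix_inv (G x)" for x
  have smoothB: "smooth_on V B"
    unfolding B_def
    by (rule smooth_on_matrix_matrix_mult[OF V smooth_on_subset[OF smoothLE VW]
          smooth_on_matrix_inv[OF V smooth_on_subset[OF smoothG VW]]]) (simp add: V_def)
  have PB: "P ** B x = mat 1" if "x \<in> V" for x
    using that matrix_inv_inverse(1)[of "G x"]
    by (simp add: B_def V_def matrix_mul_assoc G_def invertible_det_nz)
  have LB: "L x ** B x = B x" if "x \<in> V" for x
    using proj[of x] that VW by (simp add: B_def matrix_mul_assoc subset_eq)
  have injB: "inj ((*v) (B x))" if "x \<in> V" for x
    using PB[OF that] matrix_left_invertible_injective by blast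
  have rangeB: "range ((*v) (B x)) = range ((*v) (L x))" if "x \<in> V" for x
  proof (rule subspace_dim_equal)
    show "range ((*v) (B x)) \<subseteq> range ((*v) (L x))"
    proof safe
      fix a
      have "B x *v a = L x *v (B x *v a)"
        by (simp add: matrix_vector_mul_assoc LB[OF that])
      then show "B x *v a \<in> range ((*v) (L x))"
        by (rule range_eqI)
    qed
    have "rank (B x) = CARD('r)"
      using injB[OF that] by (simp add: full_rank_injective)
    then show "dim (range ((*v) (L x))) \<le> dim (range ((*v) (B x)))"
      using rank[of x] that VW by (auto simp: rank_dim_range[symmetric])
  qed (intro linear_subspace_image matrix_vector_mul_linear subspace_UNIV)+
  have comm: "frechet_derivative B (at x) (B x *v a) *v b = frechet_derivative B (at x) (B x *v b) *v a"
    if x: "x \<in> V" for x a b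
  proof -
    let ?DB = "frechet_derivative B (at x)" and ?DL = "frechet_derivative L (at x)"
    have xW: "x \<in> W" using x VW by blast
    have dB: "((\<lambda>y. B y *v c) has_derivative (\<lambda>v. ?DB v *v c)) (at x)" for c
      by (rule has_derivative_matrix_vector_mult_const[OF smooth_on_has_derivative[OF smoothB x]])
    have 1: "L x *v (?DB v *v c) + ?DL v *v (B x *v c) = ?DB v *v c" for v c
      by (rule has_derivative_matrix_vector_eq[OF V x smooth_on_has_derivative[OF smooth xW] dB dB])
        (simp add: matrix_vector_mul_assoc LB)
    have 2: "P *v (?DB v *v c) = 0" for v c
      using has_derivative_matrix_vector_eq[OF V x has_derivative_const dB has_derivative_const, of P c c v] PB
      by (simp add: matrix_vector_mul_assoc)
    \<comment> \<open>\<open>z\<close> is the bracket of the frame fields B a and B b. The symmetry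
      of DL puts it in the image of L, the constancy of P B puts it in the kernel of P, and P is
      injective on that image.\<close>
    define z where "z = ?DB (B x *v a) *v b - ?DB (B x *v b) *v a"
    have "?DL (B x *v a) *v (B x *v b) = ?DL (B x *v b) *v (B x *v a)"
      by (rule inv[OF xW]) (simp_all add: matrix_vector_mul_assoc LB[OF x])
    then have "L x *v z = (L x *v (?DB (B x *v a) *v b) + ?DL (B x *v a) *v (B x *v b))
        - (L x *v (?DB (B x *v b) *v a) + ?DL (B x *v b) *v (B x *v a))"
      by (simp only: z_def matrix_vector_mult_diff_distrib) simp
    then have "L x *v z = z"
      by (simp only: 1 z_def)
    then obtain c where c: "z = B x *v c"
      using rangeB[OF x] by (metis rangeI image_iff)
    have "P *v z = 0"
      by (simp add: z_def matrix_vector_mult_diff_distrib 2)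
    then have "c = 0"
      using PB[OF x] by (simp add: c matrix_vector_mul_assoc)
    then show ?thesis
      using c by (simp add: z_def)
  qed
  obtain \<rho> \<phi> where \<phi>: "\<rho> > 0" "\<phi> 0 = x\<^sub>0" "\<phi> ` ball 0 \<rho> \<subseteq> V"
    "\<And>y. y \<in> ball 0 \<rho> \<Longrightarrow> (\<phi> has_derivative (\<lambda>a. B (\<phi> y) *v a)) (at y)"
    using total_differential_equation[OF V x0V smoothB comm] by blast
  have D: "frechet_derivative \<phi> (at y) = (*v) (B (\<phi> y))" if "y \<in> ball 0 \<rho>" for y
    using frechet_derivative_at[OF \<phi>(4)[OF that]] by simp
  show thesis
  proof (rule that[of \<rho> \<phi> P])
    show "\<rho> > 0" "\<phi> 0 = x\<^sub>0"
      by (rule \<phi>)+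
    show "\<phi> ` ball 0 \<rho> \<subseteq> W"
      using \<phi>(3) VW by blast
    show "smooth_on (ball 0 \<rho>) \<phi>"
      by (rule smooth_on_total_differential_solution[OF open_ball V smoothB \<phi>(3,4)])
    fix y :: "real ^ 'r" assume y: "y \<in> ball 0 \<rho>"
    then have yV: "\<phi> y \<in> V"
      using \<phi>(3) by blast
    show "inj (frechet_derivative \<phi> (at y))"
      and "range (frechet_derivative \<phi> (at y)) = range ((*v) (L (\<phi> y)))"
      using injB[OF yV] rangeB[OF yV] D[OF y] by simp_all
    \<comment> \<open>The derivative is P B - 1 = 0. The resulting formula makes \<phi> injective
      with an affine left inverse, from which a chart of the integral manifold is built.\<close>
    have "((\<lambda>y. P *v \<phi> y - y) has_derivative (\<lambda>a. 0)) (at z within ball 0 \<rho>)" if z: "z \<in> ball 0 \<rho>" for z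
    proof -
      have zV: "\<phi> z \<in> V"
        using z \<phi>(3) by blast
      have "((\<lambda>y. P *v \<phi> y - y) has_derivative (\<lambda>a. P *v (B (\<phi> z) *v a) - a)) (at z)"
        by (intro has_derivative_diff has_derivative_ident
            bounded_linear.has_derivative[OF matrix_vector_mul_bounded_linear] \<phi>(4) z)
      then show ?thesis
        using PB[OF zV] by (simp add: matrix_vector_mul_assoc has_derivative_at_withinI)
    qed
    then have "P *v \<phi> y - y = P *v \<phi> 0 - 0"
      using has_derivative_zero_unique[OF convex_ball, of 0 \<rho> "\<lambda>y. P *v \<phi> y - y" 0 y] y \<phi>(1) by auto
    then show "P *v \<phi> y = y + P *v x\<^sub>0"
      by (simp add: \<phi>(2) algebra_simps)
  qed
qed

section \<open>Extension of scalars\<close>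

text \<open>The functional \<tau> of the overview: the coordinate along 1 for the inner product of
  the scalar field, which is the real part for complex scalars.\<close>

definition scalar_re :: "'k::{real_normed_field,euclidean_space} \<Rightarrow> real" where
  "scalar_re z = (z \<bullet> 1) / (1 \<bullet> (1::'k))"

lemma bounded_linear_scalar_re: "bounded_linear scalar_re"
  unfolding scalar_re_def[abs_def]
  by (rule bounded_linear_compose[OF bounded_linear_divide bounded_linear_inner_left])

lemma scalar_re_of_real_mult [simp]: "scalar_re (of_real x * z) = x * scalar_re z"
  by (simp add: scalar_re_def scaleR_conv_of_real[symmetric])

lemma scalar_re_of_real [simp]: "scalar_re (of_real x) = x"
  using scalar_re_of_real_mult[of x 1] by (simp add: scalar_re_def del: scalar_re_of_real_mult)

lemma scalar_re_linear [simp]: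
  "scalar_re (a + b) = scalar_re a + scalar_re b" "scalar_re (- a) = - scalar_re a" "scalar_re 0 = 0"
  "scalar_re (sum f I) = (\<Sum>i\<in>I. scalar_re (f i))" "scalar_re (a - b) = scalar_re a - scalar_re b"
proof -
  interpret bounded_linear scalar_re by (rule bounded_linear_scalar_re)
  show "scalar_re (a + b) = scalar_re a + scalar_re b" "scalar_re (- a) = - scalar_re a" "scalar_re 0 = 0"
    "scalar_re (sum f I) = (\<Sum>i\<in>I. scalar_re (f i))" "scalar_re (a - b) = scalar_re a - scalar_re b"
    by (rule add neg zero sum diff)+
qed

abbreviation ext_mat :: "real ^ 'n ^ 'm \<Rightarrow> 'k::{real_normed_field,euclidean_space} ^ 'n ^ 'm" where
  "ext_mat \<equiv> map_matrix of_real"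

definition map_vec :: "('a \<Rightarrow> 'b) \<Rightarrow> 'a ^ 'n \<Rightarrow> 'b ^ 'n" where
  "map_vec f v = (\<chi> i. f (v $ i))"

abbreviation ext_vec :: "real ^ 'n \<Rightarrow> 'k::{real_normed_field,euclidean_space} ^ 'n" where
  "ext_vec \<equiv> map_vec of_real"

lemma map_vec_nth [simp]: "map_vec f v $ i = f (v $ i)"
  by (simp add: map_vec_def)

lemma ext_mat_mult: "ext_mat (T ** U) = ext_mat T ** ext_mat U"
  by (simp add: vec_eq_iff matrix_matrix_mult_def)

lemma ext_mat_mat_1 [simp]: "ext_mat (mat 1) = mat 1"
  by (simp add: vec_eq_iff mat_def)

lemma ext_mat_mult_vec: "ext_mat T *v ext_vec v = ext_vec (T *v v)"
  by (simp add: vec_eq_iff matrix_vector_mult_def)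

lemma ext_vec_inject [simp]: "ext_vec v = ext_vec w \<longleftrightarrow> v = w"
  by (simp add: vec_eq_iff)

text \<open>\<open>scalar_re\<close> is not multiplicative, but being real-linear it passes through
  products in which one factor is a real matrix.\<close>

lemma re_mat_mult:
  "map_matrix scalar_re (ext_mat T ** U) = T ** map_matrix scalar_re U"
  "map_matrix scalar_re (U' ** ext_mat T') = map_matrix scalar_re U' ** T'"
  by (simp_all add: vec_eq_iff matrix_matrix_mult_def mult.commute[of _ "of_real _"])
    (simp add: mult.commute)

lemma re_mat_ext_mat [simp]: "map_matrix scalar_re (ext_mat T) = T"
  by (simp add: vec_eq_iff)

lemma re_vec_ext_vec [simp]: "map_vec scalar_re (ext_vec v) = v"
  by (simp add: vec_eq_iff)

lemma re_vec_mult: "map_vec scalar_re (ext_mat T *v v) = T *v map_vec scalar_re v"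
  by (simp add: vec_eq_iff matrix_vector_mult_def)

lemma range_matrix_mult_subset:
  fixes T :: "'k::semiring_1 ^ 'n ^ 'm"
  shows "range ((*v) (T ** U)) \<subseteq> range ((*v) T)"
  by (auto simp: matrix_vector_mul_assoc[symmetric])

lemma range_subset_imp_matrix_factor:
  fixes T :: "real ^ 'a ^ 'c" and U :: "real ^ 'b ^ 'c"
  assumes "range ((*v) T) \<subseteq> range ((*v) U)"
  obtains X where "T = U ** X"
proof -
  have "\<exists>v. T *v axis j 1 = U *v v" for j
    using assms by blast
  then obtain f where f: "\<And>j. T *v axis j 1 = U *v f j"
    by metis
  have "T = U ** (\<chi> i j. f j $ i)"
    using f by (simp add: vec_eq_iff matrix_matrix_mult_def matrix_vector_mult_def axis_def
        if_distrib[where f="\<lambda>x. _ * x"] cong: if_cong)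
  then show thesis by (rule that)
qed

text \<open>Inclusion of ranges amounts to a matrix factorization, and factorizations survive
  extension of scalars.\<close>

lemma range_ext_mat_eq:
  fixes T :: "real ^ 'a ^ 'c" and U :: "real ^ 'b ^ 'c"
  assumes "range ((*v) T) = range ((*v) U)"
  shows "range ((*v) (ext_mat T :: 'k::{real_normed_field,euclidean_space} ^ _ ^ _)) =
         range ((*v) (ext_mat U :: 'k ^ _ ^ _))"
proof -
  obtain X where X: "T = U ** X"
    by (rule range_subset_imp_matrix_factor[OF eq_refl[OF assms]])
  obtain Y where Y: "U = T ** Y"
    by (rule range_subset_imp_matrix_factor[OF eq_refl[OF assms[symmetric]]])
  have "ext_mat T = ext_mat U ** (ext_mat X :: 'k ^ _ ^ _)" "ext_mat U = ext_mat T ** (ext_mat Y :: 'k ^ _ ^ _)"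
    using arg_cong[OF X, of ext_mat] arg_cong[OF Y, of ext_mat] by (simp_all only: ext_mat_mult)
  then have "range ((*v) (ext_mat T :: 'k ^ _ ^ _)) \<subseteq> range ((*v) (ext_mat U :: 'k ^ _ ^ _))"
    "range ((*v) (ext_mat U :: 'k ^ _ ^ _)) \<subseteq> range ((*v) (ext_mat T :: 'k ^ _ ^ _))"
    using range_matrix_mult_subset by metis+
  then show ?thesis
    by (rule order_antisym)
qed

section \<open>Polynomials in a matrix and the projection l\<close>

lemma mpow_simps: "mpow T 0 = mat 1" "mpow T (Suc k) = T ** mpow T k"
  by (simp_all add: mpow_def)

lemma mpow_commute: "mpow T k ** T = T ** mpow T k"
  by (induction k) (simp_all add: mpow_simps, metis matrix_mul_assoc)

lemma mpow_ext_mat: "mpow (ext_mat T) k = ext_mat (mpow T k)"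
  by (induction k) (simp_all add: mpow_simps ext_mat_mult)

lemma mscale_mult:
  fixes T :: "'k::comm_semiring_1 ^ 'n::finite ^ 'n"
  shows "mscale a (T ** U) = mscale a T ** U" "mscale a (T ** U) = T ** mscale a U"
  by (simp_all add: mscale_def vec_eq_iff matrix_matrix_mult_def sum_distrib_left mult_ac)

lemma re_mscale: "map_matrix scalar_re (mscale a (ext_mat T)) = scalar_re a *\<^sub>R T"
  by (simp add: mscale_def vec_eq_iff mult.commute[of a])

lemma mul_distribs:
  fixes T :: "'k::ring_1 ^ 'n ^ 'm"
  shows "(T + U) ** X = T ** X + U ** X" "X' ** (T + U) = X' ** T + X' ** U"
    "(T - U) ** X = T ** X - U ** X" "X' ** (T - U) = X' ** T - X' ** U"
    "(- T) ** X = - (T ** X)" "X' ** (- T) = - (X' ** T)"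
  by (simp_all add: vec_eq_iff matrix_matrix_mult_def sum.distrib algebra_simps sum_negf sum_subtractf)

lemma scaleR_mult:
  fixes T :: "real ^ 'n ^ 'm"
  shows "(c *\<^sub>R T) ** U = c *\<^sub>R (T ** U)" "T ** (c *\<^sub>R U) = c *\<^sub>R (T ** U)"
  by (simp_all add: vec_eq_iff matrix_matrix_mult_def sum_distrib_left mult_ac)

definition real_l :: "real ^ 'n::finite ^ 'n \<Rightarrow> 'k::{real_normed_field,euclidean_space} \<Rightarrow> 'k \<Rightarrow> nat \<Rightarrow> real ^ 'n ^ 'n"
  where "real_l T \<alpha> \<beta> K = - (scalar_re \<alpha> *\<^sub>R mpow T K + scalar_re \<beta> *\<^sub>R mpow T (K - 1))"

text \<open>Taking real parts of the coefficients preserves the polynomial identity because \<open>T\<close> is real. Hence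
  both the complex and the real polynomial are the projection onto the image of \<open>T\<close> along its kernel.\<close>

lemma real_l_projection:
  fixes T :: "real ^ 'n::finite ^ 'n" and \<alpha> \<beta> :: "'k::{real_normed_field,euclidean_space}"
  assumes "2 \<le> K"
    and poly: "mscale \<alpha> (mpow (ext_mat T) (K + 1)) + mscale \<beta> (mpow (ext_mat T) K) + ext_mat T = 0"
  shows "- (mscale \<alpha> (mpow (ext_mat T) K) + mscale \<beta> (mpow (ext_mat T) (K - 1))) = ext_mat (real_l T \<alpha> \<beta> K)"
    and "real_l T \<alpha> \<beta> K ** real_l T \<alpha> \<beta> K = real_l T \<alpha> \<beta> K"
    and "rank (real_l T \<alpha> \<beta> K) = rank T"
proof -
  define l where "l = - (mscale \<alpha> (mpow (ext_mat T) K) + mscale \<beta> (mpow (ext_mat T) (K - 1)))"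
  define L where "L = real_l T \<alpha> \<beta> K"
  obtain k where K: "K = Suc (Suc k)"
    using assms(1) by (metis One_nat_def Suc_1 Suc_le_D Suc_le_mono)
  have re_l: "map_matrix scalar_re l = L"
  proof -
    have "map_matrix scalar_re (- (A + B)) = - (map_matrix scalar_re A + map_matrix scalar_re B)"
      for A B :: "'k ^ 'n ^ 'n"
      by (simp add: vec_eq_iff)
    then show ?thesis
      by (simp add: l_def L_def real_l_def mpow_ext_mat re_mscale)
  qed
  \<comment> \<open>\<open>X\<close> is \<open>l\<close> with one factor \<open>T\<close> removed.
    The exponent K - 2 is a difference of natural numbers, whence 2 \<le> K.\<close>
  define X where "X = - (mscale \<alpha> (mpow (ext_mat T) (K - 1)) + mscale \<beta> (mpow (ext_mat T) (K - 2)))"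
  have lX: "l = ext_mat T ** X" "l = X ** ext_mat T"
    by (simp_all add: l_def X_def K mpow_simps mul_distribs mscale_mult[symmetric])
      (simp_all add: mpow_commute[symmetric] mpow_simps(2)[symmetric] matrix_mul_assoc mscale_mult[symmetric])
  have "l ** ext_mat T = - (mscale \<alpha> (mpow (ext_mat T) (K + 1)) + mscale \<beta> (mpow (ext_mat T) K))"
    by (simp add: l_def K mpow_simps mul_distribs mscale_mult[symmetric] mpow_commute matrix_mul_assoc[symmetric])
  then have lT: "l ** ext_mat T = ext_mat T"
    using poly by (metis add.inverse_unique)
  have "ext_mat T ** l = l ** ext_mat T"
    using lX by (metis matrix_mul_assoc)
  then have Tl: "ext_mat T ** l = ext_mat T"
    using lT by simp
  have LT: "L ** T = T"
    using arg_cong[OF lT, of "map_matrix scalar_re"] by (simp add: re_mat_mult re_l)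
  have TL: "T ** L = T"
    using arg_cong[OF Tl, of "map_matrix scalar_re"] by (simp add: re_mat_mult re_l)
  obtain Y where Y: "L = T ** Y"
    using arg_cong[OF lX(1), of "map_matrix scalar_re"] by (simp add: re_mat_mult re_l)
  \<comment> \<open>L = T Y has its columns in the image of T, which l fixes; the next equation
    writes l as X T and uses T L = T. Comparing the two values of l L identifies l with L.\<close>
  have "l ** ext_mat L = ext_mat L"
    using lT by (metis Y ext_mat_mult matrix_mul_assoc)
  moreover have "l ** ext_mat L = l"
    using lX(2) TL by (metis ext_mat_mult matrix_mul_assoc)
  ultimately show "- (mscale \<alpha> (mpow (ext_mat T) K) + mscale \<beta> (mpow (ext_mat T) (K - 1))) = ext_mat (real_l T \<alpha> \<beta> K)"
    by (simp add: l_def L_def)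
  show "real_l T \<alpha> \<beta> K ** real_l T \<alpha> \<beta> K = real_l T \<alpha> \<beta> K"
    using LT unfolding L_def[symmetric] by (metis Y matrix_mul_assoc)
  show "rank (real_l T \<alpha> \<beta> K) = rank T"
    unfolding L_def[symmetric] using rank_mul_le_left[of T Y] rank_mul_le_left[of L T] LT Y by simp
qed

lemma smooth_on_mpow:
  fixes T :: "'v::euclidean_space \<Rightarrow> real ^ 'n::finite ^ 'n"
  assumes "open S" "smooth_on S T"
  shows "smooth_on S (\<lambda>x. mpow (T x) k)"
  by (induction k) (simp_all add: mpow_simps assms smooth_on_const smooth_on_matrix_matrix_mult)

lemma smooth_on_real_l:
  fixes T :: "'v::euclidean_space \<Rightarrow> real ^ 'n::finite ^ 'n"
  assumes "open S" "smooth_on S T"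
  shows "smooth_on S (\<lambda>x. real_l (T x) \<alpha> \<beta> K)"
  unfolding real_l_def
  by (intro smooth_on_minus smooth_on_add smooth_on_scaleR smooth_on_const smooth_on_mpow assms)

text \<open>A polynomial in T obeys the same change-of-chart law as T; with a Jacobian for J this
  makes L a tensor field.\<close>

lemma real_l_intertwine:
  fixes J :: "real ^ 'n::finite ^ 'n"
  assumes "T' ** J = J ** T"
  shows "real_l T' \<alpha> \<beta> K ** J = J ** real_l T \<alpha> \<beta> K"
proof -
  have "mpow T' k ** J = J ** mpow T k" for k
  proof (induction k)
    case (Suc k)
    then show ?case
      using assms by (simp add: mpow_simps) (metis matrix_mul_assoc)
  qed (simp add: mpow_simps)
  then show ?thesis
    by (simp add: real_l_def mul_distribs scaleR_mult)
qed

section \<open>Charts and tangent spaces\<close>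

lemma chart_inv_apply: "inj_on (snd c) (fst c) \<Longrightarrow> p \<in> fst c \<Longrightarrow> chart_inv c (snd c p) = p"
  by (simp add: chart_inv_def)

lemma transition_apply: "inj_on (snd c) (fst c) \<Longrightarrow> p \<in> fst c \<Longrightarrow> transition c d (snd c p) = snd d p"
  by (simp add: transition_def chart_inv_apply)

lemma jacobian_apply:
  assumes "transition c d differentiable (at (snd c p))"
  shows "jacobian c d p *v v = frechet_derivative (transition c d) (at (snd c p)) v"
  using fun_cong[OF matrix_vector_mul(2)[OF has_derivative_linear[OF assms[unfolded frechet_derivative_works]]], of v]
  by (simp add: jacobian_def)

text \<open>The three charts may have different dimensions, since the rule is applied within M,
  within a submanifold N, and across the inclusion of N into M.\<close>

lemma jacobian_chain:
  assumes inj: "inj_on (snd b) (fst b)" "inj_on (snd c) (fst c)"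
    and "open (snd b ` (fst b \<inter> fst c))" and p: "p \<in> fst b" "p \<in> fst c"
    and bc: "transition b c differentiable (at (snd b p))"
    and cd: "transition c d differentiable (at (snd c p))"
  shows "jacobian b d p = jacobian c d p ** jacobian b c p"
proof -
  let ?D = "\<lambda>b c. frechet_derivative (transition b c) (at (snd b p))"
  have d: "(transition b c has_derivative ?D b c) (at (snd b p))"
    "(transition c d has_derivative ?D c d) (at (transition b c (snd b p)))"
    using bc cd by (simp_all add: frechet_derivative_works[symmetric] transition_apply inj p)
  have "(transition b d has_derivative ?D c d \<circ> ?D b c) (at (snd b p))"
  proof (rule has_derivative_transform_within_open[OF diff_chain_at[OF d] assms(3)])
    show "(transition c d \<circ> transition b c) x = transition b d x" if "x \<in> snd b ` (fst b \<inter> fst c)" for x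
      using that by (auto simp: transition_apply inj)
  qed (use p in blast)
  then have "?D b d = ?D c d \<circ> ?D b c"
    using frechet_derivative_at by metis
  then show ?thesis
    unfolding jacobian_def
    using matrix_compose[OF has_derivative_linear[OF d(1)] has_derivative_linear[OF d(2)]] by simp
qed

locale manifold =
  fixes M :: "'a topology" and A :: "('a, 'n::finite) chart set"
  assumes smooth_manifold: "smooth_manifold M A"
begin

lemma chart_homeomorphic:
  "c \<in> A \<Longrightarrow> homeomorphic_map (subtopology M (fst c)) (top_of_set (snd c ` fst c)) (snd c)"
  and open_chart_range: "c \<in> A \<Longrightarrow> open (snd c ` fst c)"
  and openin_chart: "c \<in> A \<Longrightarrow> openin M (fst c)"
  and charts_cover: "(\<Union>c\<in>A. fst c) = topspace M"
  and smooth_transition: "c \<in> A \<Longrightarrow> d \<in> A \<Longrightarrow> smooth_on (snd c ` (fst c \<inter> fst d)) (transition c d)"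
  and Hausdorff: "Hausdorff_space M"
  and second_countable: "second_countable M"
  using smooth_manifold unfolding smooth_manifold_def by auto

lemma chart_subset: "c \<in> A \<Longrightarrow> fst c \<subseteq> topspace M"
  using openin_chart openin_subset by blast

lemma chart_inj: "c \<in> A \<Longrightarrow> inj_on (snd c) (fst c)"
  using homeomorphic_imp_injective_map[OF chart_homeomorphic] chart_subset
  by (simp add: inf_absorb2)

lemma snd_chart_inv: "x \<in> snd c ` fst c \<Longrightarrow> snd c (chart_inv c x) = x"
  and chart_inv_mem: "x \<in> snd c ` fst c \<Longrightarrow> chart_inv c x \<in> fst c"
  by (simp_all add: chart_inv_def f_inv_into_f inv_into_into)

lemma open_chart_image:
  assumes "c \<in> A" "openin M U"
  shows "open (snd c ` (fst c \<inter> U))"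
proof -
  have "openin (subtopology M (fst c)) (fst c \<inter> U)"
    using assms(2) by (rule openin_subtopology_Int2)
  then have "openin (top_of_set (snd c ` fst c)) (snd c ` (fst c \<inter> U))"
    using homeomorphic_imp_open_map[OF chart_homeomorphic[OF assms(1)]] by (simp add: open_map_def)
  then show ?thesis
    using open_chart_range[OF assms(1)] openin_open_trans by blast
qed

lemma open_chart_overlap: "c \<in> A \<Longrightarrow> d \<in> A \<Longrightarrow> open (snd c ` (fst c \<inter> fst d))"
  using open_chart_image openin_chart by blast

lemma transition_differentiable:
  "c \<in> A \<Longrightarrow> d \<in> A \<Longrightarrow> p \<in> fst c \<Longrightarrow> p \<in> fst d \<Longrightarrow> transition c d differentiable (at (snd c p))"
  using smooth_on_differentiable[OF smooth_transition] by blast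

lemma jacobian_trans:
  "b \<in> A \<Longrightarrow> c \<in> A \<Longrightarrow> d \<in> A \<Longrightarrow> p \<in> fst b \<Longrightarrow> p \<in> fst c \<Longrightarrow> p \<in> fst d \<Longrightarrow>
    jacobian b d p = jacobian c d p ** jacobian b c p"
  by (intro jacobian_chain chart_inj open_chart_overlap transition_differentiable)

lemma jacobian_self:
  assumes "c \<in> A" "p \<in> fst c"
  shows "jacobian c c p = mat 1"
proof -
  have "(transition c c has_derivative (\<lambda>v. v)) (at (snd c p))"
    by (rule has_derivative_transform_within_open[OF has_derivative_ident open_chart_range[OF assms(1)]])
      (use assms chart_inj in \<open>auto simp: transition_apply\<close>)
  then have "frechet_derivative (transition c c) (at (snd c p)) = (\<lambda>v. v)"
    using frechet_derivative_at by metis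
  then show ?thesis
    by (simp add: jacobian_def matrix_id_mat_1[unfolded id_def])
qed

lemma jacobian_inverse:
  "c \<in> A \<Longrightarrow> d \<in> A \<Longrightarrow> p \<in> fst c \<Longrightarrow> p \<in> fst d \<Longrightarrow> jacobian d c p ** jacobian c d p = mat 1"
  using jacobian_trans[of c d c p] jacobian_self by simp

lemma tangent_space_transform:
  "v \<in> tangent_space A p \<Longrightarrow> c \<in> A \<Longrightarrow> d \<in> A \<Longrightarrow> p \<in> fst c \<Longrightarrow> p \<in> fst d \<Longrightarrow>
    v d = ext_mat (jacobian c d p) *v v c"
  unfolding tangent_space_def by blast

lemma tangent_space_off_chart: "v \<in> tangent_space A p \<Longrightarrow> \<not> (c \<in> A \<and> p \<in> fst c) \<Longrightarrow> v c = 0"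
  unfolding tangent_space_def by blast

lemma tangent_space_eqI:
  assumes "v \<in> tangent_space A p" "w \<in> tangent_space A p" "c \<in> A" "p \<in> fst c" "v c = w c"
  shows "v = w"
proof
  fix d
  show "v d = w d"
  proof (cases "d \<in> A \<and> p \<in> fst d")
    case True
    then show ?thesis
      using tangent_space_transform[OF assms(1,3) _ assms(4)] tangent_space_transform[OF assms(2,3) _ assms(4)] assms(5)
      by metis
  next
    case False
    then show ?thesis
      by (simp add: tangent_space_off_chart[OF assms(1)] tangent_space_off_chart[OF assms(2)])
  qed
qed

lemma tangent_space_extend:
  fixes u :: "'k::{real_normed_field,euclidean_space} ^ 'n"
  assumes "c \<in> A" "p \<in> fst c"
  obtains v where "v \<in> tangent_space A p" "v c = u"
proof
  let ?v = "\<lambda>d. if d \<in> A \<and> p \<in> fst d then ext_mat (jacobian c d p) *v u else 0"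
  show "?v \<in> tangent_space A p"
    unfolding tangent_space_def
  proof (intro CollectI conjI ballI allI impI)
    fix d e assume "d \<in> A" "e \<in> A" "p \<in> fst d" "p \<in> fst e"
    then show "?v e = ext_mat (jacobian d e p) *v ?v d"
      by (simp add: jacobian_trans[OF assms(1) \<open>d \<in> A\<close> \<open>e \<in> A\<close> assms(2)]
          matrix_vector_mul_assoc ext_mat_mult)
  qed auto
  show "?v c = u"
    using assms jacobian_self by simp
qed

text \<open>The field that is constant u in the chart c is damped by a bump function and extended by
  zero.\<close>

lemma exists_vector_field:
  assumes c: "c \<in> A" "p \<in> fst c"
  obtains X :: "('a, 'n, real) vfield" where "vector_field M A X" "X p c = u"
proof -
  let ?W = "snd c ` fst c"
  obtain \<eta> :: "real ^ 'n \<Rightarrow> real" and C where \<eta>: "smooth_on UNIV \<eta>" "\<eta> (snd c p) = 1" "compact C" "C \<subseteq> ?W"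
    "\<And>x. x \<notin> C \<Longrightarrow> \<eta> x = 0"
    using smooth_bump[OF open_chart_range[OF c(1)]] c(2) by blast
  define X where "X q d = (if q \<in> fst c \<and> d \<in> A \<and> q \<in> fst d
    then \<eta> (snd c q) *\<^sub>R (jacobian c d q *v u) else 0)" for q d
  \<comment> \<open>The compact carrier of the bump function moved to M. Smoothness is checked on
    two kinds of open sets: the domain of c, where the formula applies, and the complement of
    \<open>S\<close>, where the field is 0.\<close>
  define S where "S = chart_inv c ` C"
  have "snd c ` S = C"
    using \<eta>(4) snd_chart_inv[of _ c] unfolding S_def image_image by (simp add: subset_eq)
  moreover have "S \<subseteq> fst c"
    using chart_inv_mem[OF subsetD[OF \<eta>(4)]] unfolding S_def by blast
  moreover have "compactin (top_of_set ?W) C"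
    using \<eta>(3,4) by (simp add: compactin_subtopology)
  ultimately have "compactin (subtopology M (fst c)) S"
    using homeomorphic_map_compactness[OF chart_homeomorphic[OF c(1)], of S] chart_subset[OF c(1)] by auto
  then have "closedin M S"
    using Hausdorff compactin_imp_closedin by (auto simp: compactin_subtopology)
  then have openS: "openin M (topspace M - S)"
    by (simp add: openin_diff)
  have "vector_field M A X"
    unfolding vector_field_def
  proof (intro conjI ballI)
    fix q
    show "X q \<in> tangent_space A q"
    proof (cases "q \<in> fst c")
      case True
      have "X q e = ext_mat (jacobian d e q) *v X q d" if "d \<in> A" "e \<in> A" "q \<in> fst d" "q \<in> fst e" for d e
      proof -
        have "ext_mat T = T" for T :: "real ^ 'n ^ 'n"
          by (simp add: vec_eq_iff)
        then show ?thesis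
          using True that
          by (simp add: X_def matrix_vector_mult_scaleR matrix_vector_mul_assoc
              jacobian_trans[OF c(1) that(1,2) True that(3,4)])
      qed
      then show ?thesis
        unfolding tangent_space_def
      proof (intro CollectI conjI ballI allI impI)
        show "X q d = 0" if "\<not> (d \<in> A \<and> q \<in> fst d)" for d
          using that by (auto simp: X_def)
      qed
    next
      case False
      then show ?thesis
        unfolding tangent_space_def by (simp add: X_def)
    qed
  next
    fix d assume d: "d \<in> A"
    show "smooth_on (snd d ` fst d) (\<lambda>x. X (chart_inv d x) d)"
    proof (rule smooth_on_local)
      fix x assume "x \<in> snd d ` fst d"
      then obtain q where q: "q \<in> fst d" "x = snd d q" by blast
      note di = chart_inv_apply[OF chart_inj[OF d]]
      show "\<exists>U. open U \<and> x \<in> U \<and> smooth_on U (\<lambda>x. X (chart_inv d x) d)"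
      proof (cases "q \<in> fst c")
        case True
        let ?U = "snd d ` (fst d \<inter> fst c)"
        have U: "open ?U"
          using open_chart_overlap[OF d c(1)] .
        have sub: "transition d c ` ?U \<subseteq> snd c ` (fst c \<inter> fst d)"
          using chart_inj[OF d] by (auto simp: transition_apply)
        have "smooth_on ?U (\<lambda>x. \<eta> (transition d c x) *\<^sub>R
            frechet_derivative (transition c d) (at (transition d c x)) u)"
        proof (rule smooth_on_scaleR[OF U])
          show "smooth_on ?U (\<lambda>x. \<eta> (transition d c x))"
            by (rule smooth_on_compose[OF U open_UNIV _ smooth_transition[OF d c(1)] \<eta>(1)]) simp
          show "smooth_on ?U (\<lambda>x. frechet_derivative (transition c d) (at (transition d c x)) u)"
            by (rule smooth_on_compose[OF U open_chart_overlap[OF c(1) d] sub smooth_transition[OF d c(1)]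
                  smooth_on_frechet_derivative[OF smooth_transition[OF c(1) d]]])
        qed
        then have "smooth_on ?U (\<lambda>x. X (chart_inv d x) d)"
        proof (rule smooth_on_cong[OF U, rotated])
          fix x assume "x \<in> ?U"
          then obtain q where q: "q \<in> fst d" "q \<in> fst c" "x = snd d q" by blast
          then show "\<eta> (transition d c x) *\<^sub>R frechet_derivative (transition c d) (at (transition d c x)) u
              = X (chart_inv d x) d"
            using d by (simp add: X_def di transition_apply[OF chart_inj[OF d]] jacobian_apply
                transition_differentiable[OF c(1) d])
        qed
        then show ?thesis
          using U q True by blast
      next
        case False
        let ?U = "snd d ` (fst d \<inter> (topspace M - S))"
        have U: "open ?U"
          using open_chart_image[OF d openS] .
        have "smooth_on ?U (\<lambda>x. X (chart_inv d x) d)"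
        proof (rule smooth_on_cong[OF U _ smooth_on_const[OF U]])
          fix x assume "x \<in> ?U"
          then obtain q where q: "q \<in> fst d" "q \<notin> S" "x = snd d q" by blast
          have "\<eta> (snd c q) = 0" if "q \<in> fst c"
            using q(2) \<eta>(5) chart_inv_apply[OF chart_inj[OF c(1)] that] by (force simp: S_def)
          then show "0 = X (chart_inv d x) d"
            using q by (simp add: X_def di)
        qed
        moreover have "x \<in> ?U"
          using q False chart_subset[OF d] \<open>S \<subseteq> fst c\<close> by blast
        ultimately show ?thesis
          using U by blast
      qed
    qed
  qed
  moreover have "X p c = u"
    using c \<eta>(2) jacobian_self by (simp add: X_def)
  ultimately show thesis
    by (rule that)
qed

end

section \<open>Immersed submanifolds in charts\<close>

lemma open_immersed_overlap:
  fixes A :: "('a, 'n::finite) chart set" and B :: "('a, 'r::finite) chart set"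
  assumes "smooth_manifold M A" "immersed_submanifold N B M A" "d \<in> B" "c \<in> A"
  shows "open (snd d ` (fst d \<inter> fst c))"
proof -
  interpret M: manifold M A
    using assms(1) by unfold_locales
  interpret N: manifold N B
    using assms(2) by unfold_locales (simp add: immersed_submanifold_def)
  have "openin N {x \<in> topspace N. x \<in> fst c}"
    using assms(2) M.openin_chart[OF assms(4)] openin_continuous_map_preimage
    unfolding immersed_submanifold_def by blast
  then have "open (snd d ` (fst d \<inter> {x \<in> topspace N. x \<in> fst c}))"
    by (rule N.open_chart_image[OF assms(3)])
  moreover have "fst d \<inter> {x \<in> topspace N. x \<in> fst c} = fst d \<inter> fst c"
    using N.chart_subset[OF assms(3)] by blast
  ultimately show ?thesis by simp
qed

text \<open>\<open>inclusion_image\<close> quantifies over all pairs of charts. The chain rule on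
  the side of N and on the side of M reduces it to a single pair.\<close>

lemma immersed_inclusion_image:
  fixes A :: "('a, 'n::finite) chart set" and B :: "('a, 'r::finite) chart set"
  assumes "smooth_manifold M A" "immersed_submanifold N B M A"
    and d: "d \<in> B" "q \<in> fst d" and c: "c \<in> A" "q \<in> fst c"
  shows "(inclusion_image B A q :: ('a, 'n, 'k::{real_normed_field,euclidean_space}) tvec set) =
    {w \<in> tangent_space A q. w c \<in> range ((*v) (ext_mat (jacobian d c q)))}" (is "_ = ?R")
proof -
  interpret M: manifold M A
    using assms(1) by unfold_locales
  interpret N: manifold N B
    using assms(2) by unfold_locales (simp add: immersed_submanifold_def)
  have sm: "smooth_on (snd d ` (fst d \<inter> fst c)) (transition d c)" if "d \<in> B" "c \<in> A" for c d
    using assms(2) that unfolding immersed_submanifold_def by blast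
  have diff: "transition d c differentiable (at (snd d q))"
    if "d \<in> B" "c \<in> A" "q \<in> fst d" "q \<in> fst c" for c d
    using smooth_on_differentiable[OF sm[OF that(1,2)]] that by blast
  note open_dc = open_immersed_overlap[OF assms(1,2)]
  have chain1: "jacobian d c' q = jacobian c c' q ** jacobian d c q"
    if "d \<in> B" "c \<in> A" "c' \<in> A" "q \<in> fst d" "q \<in> fst c" "q \<in> fst c'" for c c' d
    by (intro jacobian_chain N.chart_inj M.chart_inj open_dc diff M.transition_differentiable that)
  have chain2: "jacobian d c q = jacobian d' c q ** jacobian d d' q"
    if "d \<in> B" "d' \<in> B" "c \<in> A" "q \<in> fst d" "q \<in> fst d'" "q \<in> fst c" for c d d'
    by (intro jacobian_chain N.chart_inj N.open_chart_overlap N.transition_differentiable diff that)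
  show ?thesis
  proof (intro subset_antisym subsetI)
    fix w :: "('a, 'n, 'k) tvec" assume "w \<in> inclusion_image B A q"
    then show "w \<in> ?R"
      using c d unfolding inclusion_image_def by blast
  next
    fix w :: "('a, 'n, 'k) tvec" assume "w \<in> ?R"
    then obtain a where w: "w \<in> tangent_space A q" "w c = ext_mat (jacobian d c q) *v a"
      by blast
    obtain v where v: "v \<in> tangent_space B q" "v d = a"
      using N.tangent_space_extend[OF d] by blast
    have "w c' = ext_mat (jacobian d' c' q) *v v d'"
      if "d' \<in> B" "c' \<in> A" "q \<in> fst d'" "q \<in> fst c'" for c' d'
    proof -
      have "w c' = ext_mat (jacobian d c' q) *v a"
        using M.tangent_space_transform[OF w(1) c(1) that(2) c(2) that(4)] w(2)
          chain1[OF d(1) c(1) that(2) d(2) c(2) that(4)]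
        by (simp add: matrix_vector_mul_assoc ext_mat_mult)
      also have "\<dots> = ext_mat (jacobian d' c' q) *v v d'"
        using N.tangent_space_transform[OF v(1) d(1) that(1) d(2) that(3)] v(2)
          chain2[OF d(1) that(1,2) d(2) that(3,4)]
        by (simp add: matrix_vector_mul_assoc ext_mat_mult)
      finally show ?thesis .
    qed
    then show "w \<in> inclusion_image B A q"
      using w(1) v(1) unfolding inclusion_image_def by blast
  qed
qed

section \<open>Brackets and integral manifolds of the image of l\<close>

text \<open>The choice predicates of both derivatives coincide, so equality holds even where the
  functions are not differentiable. This lets \<open>lie_bracket_cong\<close> do without smoothness
  assumptions.\<close>

lemma frechet_derivative_cong_open:
  assumes "open S" "x \<in> S" "\<And>y. y \<in> S \<Longrightarrow> f y = g y"
  shows "frechet_derivative f (at x) = frechet_derivative g (at x)"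
proof -
  have "(f has_derivative D) (at x) \<longleftrightarrow> (g has_derivative D) (at x)" for D
    using has_derivative_transform_within_open[OF _ assms(1,2), where f = f and g = g]
      has_derivative_transform_within_open[OF _ assms(1,2), where f = g and g = f] assms(3) by metis
  then show ?thesis
    by (simp add: frechet_derivative_def)
qed

lemma ext_vfield_apply: "ext_vfield X p c = ext_vec (X p c)"
  by (simp add: ext_vfield_def map_vec_def)

context manifold
begin

lemma lie_bracket_cong:
  assumes "c \<in> A" "\<And>q. q \<in> fst c \<Longrightarrow> X q c = X' q c" "\<And>q. q \<in> fst c \<Longrightarrow> Y q c = Y' q c"
  shows "lie_bracket A X Y p c = lie_bracket A X' Y' p c"
proof (cases "p \<in> fst c")
  case True
  have "frechet_derivative (\<lambda>x. Z (chart_inv c x) c $ j) (at (snd c p)) =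
      frechet_derivative (\<lambda>x. Z' (chart_inv c x) c $ j) (at (snd c p))"
    if "\<And>q. q \<in> fst c \<Longrightarrow> Z q c = Z' q c" for Z Z' :: "('a, 'n, 'b) vfield" and j
    by (rule frechet_derivative_cong_open[OF open_chart_range[OF assms(1)] imageI[OF True]])
      (simp add: that[OF chart_inv_mem])
  from this[of X X', OF assms(2)] this[of Y Y', OF assms(3)] show ?thesis
    unfolding lie_bracket_def by (simp only: assms(2,3)[OF True])
qed (simp add: lie_bracket_def)

text \<open>For fields with real components differentiation commutes with extension of scalars, and
  linearity of the derivatives collapses the coordinate sums.\<close>

lemma lie_bracket_ext:
  fixes X Y :: "('a, 'n, 'k::{real_normed_field,euclidean_space}) vfield"
  assumes c: "c \<in> A" "p \<in> fst c"
    and X: "\<And>x. x \<in> snd c ` fst c \<Longrightarrow> X (chart_inv c x) c = ext_vec (U x)"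
    and Y: "\<And>x. x \<in> snd c ` fst c \<Longrightarrow> Y (chart_inv c x) c = ext_vec (V x)"
    and U: "(U has_derivative U') (at (snd c p))" and V: "(V has_derivative V') (at (snd c p))"
  shows "lie_bracket A X Y p c = ext_vec (V' (U (snd c p)) - U' (V (snd c p)))"
proof -
  have x: "snd c p \<in> snd c ` fst c" using c by blast
  have D: "frechet_derivative (\<lambda>x. Z (chart_inv c x) c $ j) (at (snd c p)) = (\<lambda>v. of_real (T' v $ j))"
    if Z: "\<And>x. x \<in> snd c ` fst c \<Longrightarrow> Z (chart_inv c x) c = ext_vec (T x)"
      and T: "(T has_derivative T') (at (snd c p))" for Z :: "('a, 'n, 'k) vfield" and T T' j
  proof -
    have "((\<lambda>x. of_real (T x $ j) :: 'k) has_derivative (\<lambda>v. of_real (T' v $ j))) (at (snd c p))"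
      by (rule bounded_linear.has_derivative[OF bounded_linear_of_real
            bounded_linear.has_derivative[OF bounded_linear_vec_nth T]])
    then have "frechet_derivative (\<lambda>x. of_real (T x $ j) :: 'k) (at (snd c p)) = (\<lambda>v. of_real (T' v $ j))"
      using frechet_derivative_at by metis
    then show ?thesis
      using frechet_derivative_cong_open[OF open_chart_range[OF c(1)] x, of "\<lambda>x. Z (chart_inv c x) c $ j"
          "\<lambda>x. of_real (T x $ j)"] Z by simp
  qed
  have lin: "T' v $ j = (\<Sum>i\<in>UNIV. v $ i * T' (axis i 1) $ j)"
    if "(T has_derivative T') (at (snd c p))" for T T' :: "real ^ 'n \<Rightarrow> real ^ 'n" and v j
  proof -
    have "T' v = matrix T' *v v"
      using fun_cong[OF matrix_vector_mul(2)[OF has_derivative_linear[OF that]]] by metis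
    then show ?thesis
      by (simp add: matrix_vector_mult_def matrix_def mult.commute)
  qed
  have "lie_bracket A X Y p c $ j = of_real ((V' (U (snd c p)) - U' (V (snd c p))) $ j)" for j
    using X[OF x] Y[OF x] chart_inv_apply[OF chart_inj[OF c(1)] c(2)]
    by (simp add: lie_bracket_def c D[where Z = X and T = U, OF X U] D[where Z = Y and T = V, OF Y V] lin[OF U, of "V (snd c p)"] lin[OF V, of "U (snd c p)"]
        sum_subtractf)
  then show ?thesis
    by (simp add: vec_eq_iff)
qed

end

section \<open>The projection field L and the bracket conditions\<close>

locale F_structure = manifold M A
  for M :: "'a topology" and A :: "('a, 'n::finite) chart set" +
  fixes F :: "('a, 'n, real) tensor11" and \<alpha> \<beta> :: "'k::{real_normed_field,euclidean_space}" and K r :: nat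
  assumes F_structure: "F_structure_manifold M A F \<alpha> \<beta> K r"
begin

abbreviation l :: "('a, 'n, 'k) tensor11" where "l \<equiv> proj_l F \<alpha> \<beta> K"
abbreviation m :: "('a, 'n, 'k) tensor11" where "m \<equiv> proj_m F \<alpha> \<beta> K"

definition L :: "('a, 'n, real) tensor11" where "L p c = real_l (F p c) \<alpha> \<beta> K"

definition chart_L :: "('a, 'n) chart \<Rightarrow> real ^ 'n \<Rightarrow> real ^ 'n ^ 'n" where
  "chart_L c x = L (chart_inv c x) c"

lemma
  assumes "c \<in> A" "p \<in> fst c"
  shows l_eq: "l p c = ext_mat (L p c)"
    and L_idem: "L p c ** L p c = L p c"
    and rank_L: "rank (L p c) = r"
proof -
  have *: "2 \<le> K" "mscale \<alpha> (mpow (ext_mat (F p c)) (K + 1)) + mscale \<beta> (mpow (ext_mat (F p c)) K) + ext_mat (F p c) = 0"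
    "rank (F p c) = r"
    using F_structure assms unfolding F_structure_manifold_def ext_tensor_def by auto
  show "l p c = ext_mat (L p c)" "L p c ** L p c = L p c" "rank (L p c) = r"
    using real_l_projection[OF *(1,2)] *(3) by (simp_all add: L_def proj_l_def ext_tensor_def)
qed

lemma m_eq: "c \<in> A \<Longrightarrow> p \<in> fst c \<Longrightarrow> m p c = mat 1 - ext_mat (L p c)"
  unfolding l_eq[symmetric] by (simp add: proj_m_def proj_l_def)

lemma chart_L_apply: "c \<in> A \<Longrightarrow> p \<in> fst c \<Longrightarrow> chart_L c (snd c p) = L p c"
  by (simp add: chart_L_def chart_inv_apply chart_inj)

lemma chart_L_idem: "c \<in> A \<Longrightarrow> x \<in> snd c ` fst c \<Longrightarrow> chart_L c x ** chart_L c x = chart_L c x"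
  by (simp add: chart_L_def L_idem chart_inv_mem)

lemma smooth_chart_L: "c \<in> A \<Longrightarrow> smooth_on (snd c ` fst c) (chart_L c)"
  unfolding chart_L_def L_def
  using F_structure open_chart_range
  by (intro smooth_on_real_l) (auto simp: F_structure_manifold_def tensor_field11_def)

lemma L_transform:
  assumes "c \<in> A" "d \<in> A" "p \<in> fst c" "p \<in> fst d"
  shows "L p d ** jacobian c d p = jacobian c d p ** L p c"
  unfolding L_def
proof (rule real_l_intertwine)
  show "F p d ** jacobian c d p = jacobian c d p ** F p c"
    using F_structure assms unfolding F_structure_manifold_def tensor_field11_def by blast
qed

lemma chart_L_derivative:
  "c \<in> A \<Longrightarrow> p \<in> fst c \<Longrightarrow> (chart_L c has_derivative frechet_derivative (chart_L c) (at (snd c p))) (at (snd c p))"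
  using smooth_on_has_derivative[OF smooth_chart_L] by blast

lemma m_lie_bracket:
  assumes X: "vector_field M A X" and Y: "vector_field M A Y" and c: "c \<in> A" "p \<in> fst c"
  shows "m p c *v lie_bracket A (tapply l (ext_vfield X)) (tapply l (ext_vfield Y)) p c =
    ext_vec (frechet_derivative (chart_L c) (at (snd c p)) (L p c *v X p c) *v (L p c *v Y p c)
      - frechet_derivative (chart_L c) (at (snd c p)) (L p c *v Y p c) *v (L p c *v X p c))"
proof -
  let ?W = "snd c ` fst c" and ?x = "snd c p"
  let ?D = "frechet_derivative (chart_L c) (at (snd c p))"
  have x: "?x \<in> ?W" using c by blast
  define lift where "lift Z x = chart_L c x *v Z (chart_inv c x) c" for Z :: "('a, 'n, real) vfield" and x
  have lift_x: "lift Z ?x = L p c *v Z p c" for Z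
    by (simp add: lift_def chart_L_apply c chart_inv_apply chart_inj)
  have smooth: "smooth_on ?W (lift Z)" if "vector_field M A Z" for Z
    unfolding lift_def
    using that c(1) by (intro smooth_on_matrix_vector_mult open_chart_range smooth_chart_L)
      (auto simp: vector_field_def)
  have lift: "tapply l (ext_vfield Z) (chart_inv c x) c = ext_vec (lift Z x)" if "x \<in> ?W" for Z x
    using l_eq[OF c(1) chart_inv_mem[OF that]]
    by (simp add: tapply_def lift_def chart_L_def ext_vfield_apply ext_mat_mult_vec)
  define U' where "U' Z = frechet_derivative (lift Z) (at ?x)" for Z
  have U': "(lift Z has_derivative U' Z) (at ?x)" if "vector_field M A Z" for Z
    unfolding U'_def by (rule smooth_on_has_derivative[OF smooth[OF that] x])
  \<comment> \<open>The derivative of L(LZ) = LZ; solved for (1 - L) D(LZ) it expresses the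
    derivative of the field by that of L.\<close>
  have key: "L p c *v U' Z v + ?D v *v lift Z ?x = U' Z v" if "vector_field M A Z" for Z v
    using has_derivative_matrix_vector_eq[OF open_chart_range[OF c(1)] x chart_L_derivative[OF c] U'[OF that] U'[OF that]]
      chart_L_idem[OF c(1)]
    by (simp add: chart_L_apply c lift_def[of Z] matrix_vector_mul_assoc)
  have *: "(mat 1 - L p c) *v U' Z v = ?D v *v lift Z ?x" if "vector_field M A Z" for Z v
    using key[OF that, of v] by (simp add: matrix_vector_mult_diff_rdistrib) (metis add_diff_cancel_left')
  have "lie_bracket A (tapply l (ext_vfield X)) (tapply l (ext_vfield Y)) p c
      = ext_vec (U' Y (lift X ?x) - U' X (lift Y ?x))"
    by (rule lie_bracket_ext[OF c, where U = "lift X" and V = "lift Y" and U' = "U' X" and V' = "U' Y"])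
      (simp_all add: lift U' X Y)
  moreover have "m p c = ext_mat (mat 1 - L p c)"
    by (simp add: m_eq c vec_eq_iff mat_def)
  ultimately show ?thesis
    by (simp add: ext_mat_mult_vec matrix_vector_mult_diff_distrib *[OF X] *[OF Y] lift_x)
qed

text \<open>With b the bracket of lX and lY, idempotence turns all four brackets into b, leaving b -
  l b - l b + l b = m b. Outside the charts both sides are 0 by convention.\<close>

lemma nijenhuis_eq:
  "nijenhuis A l (tapply l (ext_vfield X)) (tapply l (ext_vfield Y)) p c =
    tapply m (lie_bracket A (tapply l (ext_vfield X)) (tapply l (ext_vfield Y))) p c"
proof (cases "c \<in> A \<and> p \<in> fst c")
  case True
  then have c: "c \<in> A" "p \<in> fst c" by auto
  have ll: "l q c *v (l q c *v z) = l q c *v z" if "q \<in> fst c" for q z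
    using that c by (simp add: l_eq matrix_vector_mul_assoc ext_mat_mult[symmetric] L_idem)
  have idem: "tapply l (tapply l Z) q c = tapply l Z q c" if "q \<in> fst c" for Z q
    using ll[OF that] by (simp add: tapply_def)
  let ?X = "tapply l (ext_vfield X)" and ?Y = "tapply l (ext_vfield Y)"
  have "lie_bracket A (tapply l ?X) (tapply l ?Y) p c = lie_bracket A ?X ?Y p c"
    "lie_bracket A (tapply l ?X) ?Y p c = lie_bracket A ?X ?Y p c"
    "lie_bracket A ?X (tapply l ?Y) p c = lie_bracket A ?X ?Y p c"
    by (rule lie_bracket_cong[OF c(1)]; simp add: idem)+
  moreover have "m p c = mat 1 - l p c"
    using m_eq[OF c] l_eq[OF c] by simp
  ultimately show ?thesis
    by (simp add: nijenhuis_def tapply_def[of _ "lie_bracket A _ _"] tapply_def[of _ "tapply _ _"] ll c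
        matrix_vector_mult_diff_rdistrib)
next
  case False
  then have "lie_bracket A X Y p c = 0" for X Y :: "('a, 'n, 'k) vfield"
    by (auto simp: lie_bracket_def)
  then show ?thesis
    by (simp add: nijenhuis_def tapply_def)
qed

text \<open>The pointwise form of involutivity of the image of \<open>L\<close>.\<close>

definition derivative_symmetric :: "('a, 'n) chart \<Rightarrow> 'a \<Rightarrow> bool" where
  "derivative_symmetric c p \<longleftrightarrow> (\<forall>u w. L p c *v u = u \<longrightarrow> L p c *v w = w \<longrightarrow>
    frechet_derivative (chart_L c) (at (snd c p)) u *v w = frechet_derivative (chart_L c) (at (snd c p)) w *v u)"

text \<open>By \<open>m_lie_bracket\<close> only the values of X and Y at p enter. Vector fields
  through given vectors u and w in the image of L therefore test the symmetry at p
  completely.\<close>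

lemma bracket_condition_iff:
  "(\<forall>X Y. vector_field M A X \<longrightarrow> vector_field M A Y \<longrightarrow>
      vanishes_on M (tapply m (lie_bracket A (tapply l (ext_vfield X)) (tapply l (ext_vfield Y)))))
    \<longleftrightarrow> (\<forall>c\<in>A. \<forall>p\<in>fst c. derivative_symmetric c p)" (is "?lhs \<longleftrightarrow> ?rhs")
proof
  assume ?rhs
  have "tapply m (lie_bracket A (tapply l (ext_vfield X)) (tapply l (ext_vfield Y))) p c = 0"
    if "vector_field M A X" "vector_field M A Y" for X Y p c
  proof (cases "c \<in> A \<and> p \<in> fst c")
    case True
    then have "derivative_symmetric c p"
      using \<open>?rhs\<close> by blast
    moreover have "L p c *v (L p c *v v) = L p c *v v" for v
      using True by (simp add: matrix_vector_mul_assoc L_idem)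
    ultimately show ?thesis
      using True m_lie_bracket[OF that]
      by (simp add: tapply_def derivative_symmetric_def vec_eq_iff)
  next
    case False
    then show ?thesis
      by (auto simp: tapply_def lie_bracket_def)
  qed
  then show ?lhs
    unfolding vanishes_on_def by blast
next
  assume lhs: ?lhs
  show ?rhs
    unfolding derivative_symmetric_def
  proof (intro ballI allI impI)
    fix c p u w
    assume c: "c \<in> A" "p \<in> fst c" and uw: "L p c *v u = u" "L p c *v w = w"
    obtain X where X: "vector_field M A X" "X p c = u"
      using exists_vector_field[OF c] by blast
    obtain Y where Y: "vector_field M A Y" "Y p c = w"
      using exists_vector_field[OF c] by blast
    have "tapply m (lie_bracket A (tapply l (ext_vfield X)) (tapply l (ext_vfield Y))) p = (\<lambda>c. 0)"
      using lhs X(1) Y(1) c chart_subset unfolding vanishes_on_def by blast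
    then have "m p c *v lie_bracket A (tapply l (ext_vfield X)) (tapply l (ext_vfield Y)) p c = 0"
      using tapply_def by metis
    then have "(ext_vec (frechet_derivative (chart_L c) (at (snd c p)) u *v w
        - frechet_derivative (chart_L c) (at (snd c p)) w *v u) :: 'k ^ 'n) = ext_vec 0"
      using m_lie_bracket[OF X(1) Y(1) c] X(2) Y(2) uw by (simp add: vec_eq_iff)
    then show "frechet_derivative (chart_L c) (at (snd c p)) u *v w = frechet_derivative (chart_L c) (at (snd c p)) w *v u"
      unfolding ext_vec_inject by simp
  qed
qed

text \<open>The counterpart of \<open>immersed_inclusion_image\<close> for the image of l: the
  transformation law of L reduces membership to one chart.\<close>

lemma image_distribution_eq:
  assumes c: "c \<in> A" "p \<in> fst c"
  shows "image_distribution A l p = {w \<in> tangent_space A p. w c \<in> range ((*v) (ext_mat (L p c)))}"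
proof -
  have T: "(\<lambda>c. l p c *v v c) \<in> tangent_space A p" if v: "v \<in> tangent_space A p" for v
    unfolding tangent_space_def
  proof (intro CollectI conjI ballI allI impI)
    fix c d assume cd: "c \<in> A" "d \<in> A" "p \<in> fst c" "p \<in> fst d"
    show "l p d *v v d = ext_mat (jacobian c d p) *v (l p c *v v c)"
      using tangent_space_transform[OF v cd] L_transform[OF cd] cd
      by (simp add: l_eq matrix_vector_mul_assoc ext_mat_mult[symmetric])
  qed (simp add: tangent_space_off_chart[OF v])
  show ?thesis
  proof (intro subset_antisym subsetI)
    show "w \<in> {w \<in> tangent_space A p. w c \<in> range ((*v) (ext_mat (L p c)))}"
      if "w \<in> image_distribution A l p" for w
      using that T l_eq[OF c] by (auto simp: image_distribution_def)
    fix w assume "w \<in> {w \<in> tangent_space A p. w c \<in> range ((*v) (ext_mat (L p c)) :: 'k ^ 'n \<Rightarrow> _)}"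
    then obtain a where w: "w \<in> tangent_space A p" "w c = ext_mat (L p c) *v a" by blast
    obtain v where v: "v \<in> tangent_space A p" "v c = a"
      using tangent_space_extend[OF c] by blast
    have "w = (\<lambda>c. l p c *v v c)"
      by (rule tangent_space_eqI[OF w(1) T[OF v(1)] c]) (simp add: w v l_eq c)
    then show "w \<in> image_distribution A l p"
      using v(1) by (auto simp: image_distribution_def)
  qed
qed

text \<open>Brings integrability from complexified tangent spaces back to real matrices: applying
  \<open>scalar_re\<close> to a complex preimage of a real vector gives a real preimage, and the
  converse is \<open>range_ext_mat_eq\<close>.\<close>

lemma inclusion_image_eq_iff:
  fixes B :: "('a, 's::finite) chart set"
  assumes imm: "immersed_submanifold N B M A" and d: "d \<in> B" "q \<in> fst d" and c: "c \<in> A" "q \<in> fst c"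
  shows "inclusion_image B A q = image_distribution A l q \<longleftrightarrow>
    range ((*v) (jacobian d c q)) = range ((*v) (L q c))"
proof -
  have sub: "range ((*v) T) \<subseteq> range ((*v) U)"
    if "range ((*v) (ext_mat T)) \<subseteq> range ((*v) (ext_mat U :: 'k ^ _ ^ _))"
    for T :: "real ^ 'x ^ 'n" and U :: "real ^ 'y ^ 'n"
  proof safe
    fix v
    have "ext_mat T *v ext_vec v \<in> range ((*v) (ext_mat U :: 'k ^ _ ^ _))"
      using that by blast
    then obtain z :: "'k ^ 'y" where "ext_vec (T *v v) = ext_mat U *v z"
      by (auto simp: ext_mat_mult_vec)
    then have "T *v v = U *v map_vec scalar_re z"
      using re_vec_mult[of U z] re_vec_ext_vec by metis
    then show "T *v v \<in> range ((*v) U)"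
      by blast
  qed
  have real_iff: "range ((*v) (jacobian d c q)) = range ((*v) (L q c)) \<longleftrightarrow>
      range ((*v) (ext_mat (jacobian d c q) :: 'k ^ _ ^ _)) = range ((*v) (ext_mat (L q c)))"
  proof
    show "range ((*v) (ext_mat (jacobian d c q) :: 'k ^ _ ^ _)) = range ((*v) (ext_mat (L q c)))"
      if "range ((*v) (jacobian d c q)) = range ((*v) (L q c))"
      using that by (rule range_ext_mat_eq)
  qed (intro subset_antisym sub; simp)
  \<comment> \<open>Every coordinate vector in c belongs to some tangent vector, so the sets of
    tangent vectors determine the sets of components.\<close>
  have "S = S'" if "{w \<in> tangent_space A q. w c \<in> S} = {w \<in> tangent_space A q. w c \<in> S'}"
    for S S' :: "('k ^ 'n) set"
  proof (rule set_eqI)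
    fix a :: "'k ^ 'n"
    obtain w where "w \<in> tangent_space A q" "w c = a"
      using tangent_space_extend[OF c] by blast
    then show "a \<in> S \<longleftrightarrow> a \<in> S'"
      using that by blast
  qed
  from this[of "range ((*v) (ext_mat (jacobian d c q)))" "range ((*v) (ext_mat (L q c)))"]
  show ?thesis
    unfolding immersed_inclusion_image[OF smooth_manifold imm d c] image_distribution_eq[OF c] real_iff
    by (intro iffI) simp_all
qed

section \<open>Integral manifolds and symmetry of DL\<close>

lemma integrable_imp_derivative_symmetric:
  assumes integrable: "integrable_distribution TYPE('s::finite) M A (image_distribution A l)"
    and c: "c \<in> A" "p \<in> fst c"
  shows "derivative_symmetric c p"
proof -
  obtain N and B :: "('a, 's) chart set" where p: "p \<in> topspace N"
    and NB: "integral_manifold N B M A (image_distribution A l)"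
    using integrable c chart_subset unfolding integrable_distribution_def by blast
  have imm: "immersed_submanifold N B M A"
    and incl: "\<And>q. q \<in> topspace N \<Longrightarrow> inclusion_image B A q = image_distribution A l q"
    using NB unfolding integral_manifold_def by auto
  interpret N: manifold N B
    using imm by unfold_locales (simp add: immersed_submanifold_def)
  obtain d where d: "d \<in> B" "p \<in> fst d"
    using p N.charts_cover by blast
  let ?V = "snd d ` (fst d \<inter> fst c)" and ?y = "snd d p"
  define \<phi> where "\<phi> = transition d c"
  have smooth: "smooth_on ?V \<phi>"
    using imm d c unfolding immersed_submanifold_def \<phi>_def by blast
  have y: "?y \<in> ?V" using d c by blast
  have V: "open ?V"
    by (rule open_immersed_overlap[OF smooth_manifold imm d(1) c(1)])
  have range: "range (frechet_derivative \<phi> (at (snd d q))) = range ((*v) (L q c))"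
    if q: "q \<in> fst d" "q \<in> fst c" for q
  proof -
    have "(*v) (jacobian d c q) = frechet_derivative \<phi> (at (snd d q))"
      using smooth_on_differentiable[OF smooth] q by (auto simp: \<phi>_def jacobian_apply)
    then show ?thesis
      using inclusion_image_eq_iff[OF imm d(1) q(1) c(1) q(2)] incl N.chart_subset[OF d(1)] q(1) by auto
  qed
  have tangent: "chart_L c (\<phi> z) *v frechet_derivative \<phi> (at z) a = frechet_derivative \<phi> (at z) a"
    if z: "z \<in> ?V" for z a
  proof -
    obtain q where q: "q \<in> fst d" "q \<in> fst c" "z = snd d q"
      using z by blast
    obtain b where "frechet_derivative \<phi> (at z) a = L q c *v b"
      using range[OF q(1,2)] q(3) by blast
    then show ?thesis
      using q c by (simp add: \<phi>_def transition_apply[OF N.chart_inj[OF d(1)]] chart_L_apply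
          matrix_vector_mul_assoc L_idem)
  qed
  have \<phi>y: "\<phi> ?y = snd c p"
    by (simp add: \<phi>_def transition_apply[OF N.chart_inj[OF d(1)]] d)
  let ?D = "frechet_derivative \<phi> (at ?y)" and ?DL = "frechet_derivative (chart_L c) (at (snd c p))"
  let ?D2 = "\<lambda>a. frechet_derivative (\<lambda>z. frechet_derivative \<phi> (at z) a) (at ?y)"
  \<comment> \<open>The derivative of \<open>tangent\<close> in direction b with a fixed. Its terms
    in the second derivative of \<phi> are symmetric in a and b, so the remaining term in DL must be
    as well.\<close>
  have second: "L p c *v ?D2 a b + ?DL (?D b) *v ?D a = ?D2 a b" for a b
  proof -
    have 1: "((\<lambda>z. chart_L c (\<phi> z)) has_derivative (\<lambda>b. ?DL (?D b))) (at ?y)"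
      using has_derivative_compose[OF smooth_on_has_derivative[OF smooth y], of "chart_L c" ?DL]
        chart_L_derivative[OF c] by (simp add: \<phi>y)
    have 2: "((\<lambda>z. frechet_derivative \<phi> (at z) a) has_derivative ?D2 a) (at ?y)"
      by (rule smooth_on_has_derivative[OF smooth_on_frechet_derivative[OF smooth] y])
    show ?thesis
      using has_derivative_matrix_vector_eq[OF V y 1 2 2, of b] tangent by (simp add: \<phi>y chart_L_apply c)
  qed
  have D2: "?D2 a b = ?D2 b a" for a b
    by (rule symmetric_second_derivative[OF V y smooth])
  show ?thesis
    unfolding derivative_symmetric_def
  proof (intro allI impI)
    fix u w assume "L p c *v u = u" "L p c *v w = w"
    then have "u \<in> range ?D" "w \<in> range ?D"
      unfolding range[OF d(2) c(2)] by (metis rangeI)+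
    then obtain a b where ab: "u = ?D a" "w = ?D b"
      by blast
    have "L p c *v ?D2 a b + ?DL (?D b) *v ?D a = L p c *v ?D2 a b + ?DL (?D a) *v ?D b"
      using second[of a b] second[of b a] D2[of a b] by simp
    then show "?DL u *v w = ?DL w *v u"
      unfolding ab by simp
  qed
qed

text \<open>The integral manifold is the image of a ball under the Frobenius parametrization, with
  the subspace topology of M and an atlas consisting of one chart.\<close>

lemma derivative_symmetric_imp_integrable:
  assumes r: "r = CARD('s::finite)" and sym: "\<And>c p. c \<in> A \<Longrightarrow> p \<in> fst c \<Longrightarrow> derivative_symmetric c p"
  shows "integrable_distribution TYPE('s) M A (image_distribution A l)"
  unfolding integrable_distribution_def
proof
  fix p assume "p \<in> topspace M"
  then obtain c where c: "c \<in> A" "p \<in> fst c"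
    using charts_cover by blast
  let ?W = "snd c ` fst c"
  note ci = chart_inv_apply[OF chart_inj[OF c(1)]]
  obtain \<rho> and \<phi> :: "real ^ 's \<Rightarrow> real ^ 'n" and P :: "real ^ 'n ^ 's" where \<rho>: "\<rho> > 0"
    and \<phi>: "\<phi> 0 = snd c p" "\<phi> ` ball 0 \<rho> \<subseteq> ?W" "smooth_on (ball 0 \<rho>) \<phi>"
    "\<And>y. y \<in> ball 0 \<rho> \<Longrightarrow> inj (frechet_derivative \<phi> (at y))"
    "\<And>y. y \<in> ball 0 \<rho> \<Longrightarrow> range (frechet_derivative \<phi> (at y)) = range ((*v) (chart_L c (\<phi> y)))"
    and P: "\<And>y. y \<in> ball 0 \<rho> \<Longrightarrow> P *v \<phi> y = y + P *v snd c p"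
  proof (rule local_frobenius[OF open_chart_range[OF c(1)] imageI[OF c(2)] smooth_chart_L[OF c(1)]])
    show "chart_L c x ** chart_L c x = chart_L c x" if "x \<in> ?W" for x
      using chart_L_idem[OF c(1) that] .
    show "rank (chart_L c x) = CARD('s)" if "x \<in> ?W" for x
      using that c(1) r by (auto simp: chart_L_apply rank_L)
    show "frechet_derivative (chart_L c) (at x) u *v w = frechet_derivative (chart_L c) (at x) w *v u"
      if x: "x \<in> ?W" and "chart_L c x *v u = u" "chart_L c x *v w = w" for x u w
      using that sym[OF c(1)] c(1) by (auto simp: chart_L_apply derivative_symmetric_def)
  qed blast
  let ?B = "ball (0 :: real ^ 's) \<rho>"
  define \<gamma> where "\<gamma> y = chart_inv c (\<phi> y)" for y
  \<comment> \<open>The formula P \<phi>(y) = y + P(snd c p) makes this a left inverse of \<gamma>.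
    It is continuous on the whole domain of c, so the subspace topology fits the chart.\<close>
  define \<psi> where "\<psi> q = P *v snd c q - P *v snd c p" for q
  have \<gamma>: "\<gamma> y \<in> fst c" "snd c (\<gamma> y) = \<phi> y" "\<psi> (\<gamma> y) = y" if "y \<in> ?B" for y
  proof -
    have "\<phi> y \<in> ?W" using that \<phi>(2) by blast
    then show "\<gamma> y \<in> fst c" "snd c (\<gamma> y) = \<phi> y"
      by (simp_all add: \<gamma>_def chart_inv_mem snd_chart_inv)
    then show "\<psi> (\<gamma> y) = y"
      using P[OF that] by (simp add: \<psi>_def)
  qed
  define S where "S = \<gamma> ` ?B"
  have S: "S \<subseteq> fst c" "S \<subseteq> topspace M"
    using \<gamma> chart_subset[OF c(1)] by (auto simp: S_def)
  have \<psi>S: "\<psi> ` S = ?B"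
    using \<gamma>(3) by (force simp: S_def)
  define d where "d = (S, \<psi>)"
  define N where "N = subtopology M S"
  have topN: "topspace N = S"
    using S by (simp add: N_def inf_absorb2)
  have inj_d: "inj_on (snd d) (fst d)"
    using \<gamma>(3) by (auto simp: d_def S_def intro!: inj_onI)
  have d_inv: "chart_inv d y = \<gamma> y" if "y \<in> ?B" for y
    using chart_inv_apply[OF inj_d, of "\<gamma> y"] that \<gamma>(3)[OF that] by (simp add: d_def S_def)
  have trans_c: "transition d c y = \<phi> y" if "y \<in> ?B" for y
    using that \<gamma>(2) by (simp add: transition_def d_inv)
  have trans_d: "transition d d y = y" if "y \<in> ?B" for y
    using that \<gamma>(3) by (simp add: transition_def d_inv) (simp add: d_def)
  have pS: "p \<in> S"
    using \<rho> \<phi>(1) ci[OF c(2)] by (auto simp: S_def \<gamma>_def intro!: image_eqI[of _ _ 0])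
  have hom: "homeomorphic_map (subtopology N (fst d)) (top_of_set (snd d ` fst d)) (snd d)"
  proof -
    have sub: "subtopology N (fst d) = N"
      by (simp add: N_def d_def subtopology_subtopology)
    have cont_c: "continuous_map (subtopology M (fst c)) (top_of_set ?W) (snd c)"
      by (rule homeomorphic_imp_continuous_map[OF chart_homeomorphic[OF c(1)]])
    have cont_\<psi>: "continuous_map N (top_of_set ?B) \<psi>"
    proof (rule continuous_map_into_subtopology)
      have "continuous_map N euclidean (snd c)"
        unfolding N_def using continuous_map_from_subtopology_mono[OF cont_c[THEN continuous_map_into_fulltopology] S(1)] .
      moreover have "continuous_map euclidean euclidean (\<lambda>x. P *v x - P *v snd c p)"
        by (auto intro!: continuous_intros matrix_vector_mult_linear_continuous_on)
      ultimately have "continuous_map N euclidean ((\<lambda>x. P *v x - P *v snd c p) \<circ> snd c)"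
        by (rule continuous_map_compose)
      then show "continuous_map N euclidean \<psi>"
        by (simp add: \<psi>_def[abs_def] o_def)
      show "\<psi> \<in> topspace N \<rightarrow> ?B"
        using \<psi>S topN by blast
    qed
    have cont_\<gamma>: "continuous_map (top_of_set ?B) N \<gamma>"
    proof -
      \<comment> \<open>\<open>chart_inv\<close> is a mere choice of preimages; its continuity is
        borrowed from the inverse \<open>g\<close> that the homeomorphism provides.\<close>
      obtain g where g: "homeomorphic_maps (subtopology M (fst c)) (top_of_set ?W) (snd c) g"
        using chart_homeomorphic[OF c(1)] homeomorphic_map_maps by blast
      have "continuous_map (top_of_set ?B) (top_of_set ?W) \<phi>"
        using smooth_on_continuous_on[OF \<phi>(3)] \<phi>(2) by (intro continuous_map_into_subtopology) auto
      moreover have "continuous_map (top_of_set ?W) (subtopology M (fst c)) g"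
        using g by (simp add: homeomorphic_maps_def)
      ultimately have "continuous_map (top_of_set ?B) (subtopology M (fst c)) (g \<circ> \<phi>)"
        by (rule continuous_map_compose)
      moreover have "(g \<circ> \<phi>) y = \<gamma> y" if "y \<in> ?B" for y
      proof -
        have "g (snd c (\<gamma> y)) = \<gamma> y"
          using g \<gamma>(1)[OF that] chart_subset[OF c(1)] by (auto simp: homeomorphic_maps_def)
        then show ?thesis
          by (simp add: \<gamma>(2)[OF that])
      qed
      ultimately have "continuous_map (top_of_set ?B) (subtopology M (fst c)) \<gamma>"
        by (rule continuous_map_eq) simp
      then have "continuous_map (top_of_set ?B) M \<gamma>"
        by (rule continuous_map_into_fulltopology)
      then show ?thesis
        unfolding N_def by (rule continuous_map_into_subtopology) (auto simp: S_def)
    qed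
    have "homeomorphic_maps N (top_of_set ?B) \<psi> \<gamma>"
      unfolding homeomorphic_maps_def using cont_\<psi> cont_\<gamma> \<gamma>(3) topN by (auto simp: S_def)
    then show ?thesis
      using homeomorphic_map_maps \<psi>S sub by (auto simp: d_def)
  qed
  have manifold: "smooth_manifold N {d}"
    unfolding smooth_manifold_def
  proof (intro conjI ballI)
    show "Hausdorff_space N" "second_countable N"
      by (simp_all add: N_def Hausdorff_space_subtopology second_countable_subtopology Hausdorff second_countable)
    show "openin N (fst e)" "open (snd e ` fst e)"
      "homeomorphic_map (subtopology N (fst e)) (top_of_set (snd e ` fst e)) (snd e)" if "e \<in> {d}" for e
      using that hom topN \<psi>S openin_topspace[of N] by (auto simp: d_def)
    show "\<Union> (fst ` {d}) = topspace N"
      by (simp add: topN d_def)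
    show "smooth_on (snd e ` (fst e \<inter> fst e')) (transition e e')" if "e \<in> {d}" "e' \<in> {d}" for e e'
    proof -
      have "smooth_on ?B (transition d d)"
        by (rule smooth_on_cong[OF open_ball _ smooth_on_id[OF open_ball]]) (simp add: trans_d)
      then show ?thesis
        using that \<psi>S by (simp add: d_def)
    qed
  qed
  have overlap: "snd d ` (fst d \<inter> fst e) = {y \<in> ?B. \<phi> y \<in> snd c ` (fst c \<inter> fst e)}" for e :: "('a, 'n) chart"
  proof -
    have iff: "\<gamma> y \<in> fst e \<longleftrightarrow> \<phi> y \<in> snd c ` (fst c \<inter> fst e)" if y: "y \<in> ?B" for y
    proof
      assume "\<gamma> y \<in> fst e"
      then show "\<phi> y \<in> snd c ` (fst c \<inter> fst e)"
        using \<gamma>(1)[OF y] by (intro image_eqI[of _ _ "\<gamma> y"]) (simp_all add: \<gamma>(2)[OF y])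
    next
      assume "\<phi> y \<in> snd c ` (fst c \<inter> fst e)"
      then obtain q where "q \<in> fst c" "q \<in> fst e" "\<phi> y = snd c q" by blast
      then show "\<gamma> y \<in> fst e"
        by (simp add: \<gamma>_def ci)
    qed
    have "snd d ` (fst d \<inter> fst e) = \<psi> ` \<gamma> ` {y \<in> ?B. \<gamma> y \<in> fst e}"
      unfolding d_def S_def fst_conv snd_conv by blast
    also have "\<dots> = {y \<in> ?B. \<gamma> y \<in> fst e}"
      using \<gamma>(3) unfolding image_image by simp
    finally show ?thesis
      using iff by blast
  qed
  have open_overlap: "open (snd d ` (fst d \<inter> fst e))" if "e \<in> A" for e
  proof -
    have "open (?B \<inter> \<phi> -` (snd c ` (fst c \<inter> fst e)))"
      using smooth_on_continuous_on[OF \<phi>(3)] open_chart_overlap[OF c(1) that]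
      by (intro continuous_open_preimage) auto
    then show ?thesis
      unfolding overlap by (rule back_subst) auto
  qed
  have jac_c: "(*v) (jacobian d c q) = frechet_derivative \<phi> (at (\<psi> q))" "transition d c differentiable (at (\<psi> q))"
    if q: "q \<in> S" for q
  proof -
    have y: "\<psi> q \<in> ?B" using q \<psi>S by blast
    have D: "(transition d c has_derivative frechet_derivative \<phi> (at (\<psi> q))) (at (\<psi> q))"
      by (rule has_derivative_transform_within_open[OF smooth_on_has_derivative[OF \<phi>(3) y] open_ball y])
        (simp add: trans_c)
    then show diff: "transition d c differentiable (at (\<psi> q))"
      using differentiable_def by blast
    show "(*v) (jacobian d c q) = frechet_derivative \<phi> (at (\<psi> q))"
      using jacobian_apply[of d c q] diff unfolding frechet_derivative_at[OF D] by (auto simp: d_def)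
  qed
  have imm: "immersed_submanifold N {d} M A"
    unfolding immersed_submanifold_def
  proof (intro conjI ballI manifold)
    show "topspace N \<subseteq> topspace M"
      using S topN by simp
    show "continuous_map N M (\<lambda>q. q)"
      by (simp add: N_def)
    fix d' e assume "d' \<in> {d}" and e: "e \<in> A"
    then have d': "d' = d" by simp
    show "smooth_on (snd d' ` (fst d' \<inter> fst e)) (transition d' e)"
      unfolding d'
    proof (rule smooth_on_cong[OF open_overlap[OF e]])
      show "smooth_on (snd d ` (fst d \<inter> fst e)) (\<lambda>y. transition c e (\<phi> y))"
        by (rule smooth_on_compose[OF open_overlap[OF e] open_chart_overlap[OF c(1) e] _
              smooth_on_subset[OF \<phi>(3)] smooth_transition[OF c(1) e]])
          (auto simp: overlap)
      show "transition c e (\<phi> y) = transition d e y" if "y \<in> snd d ` (fst d \<inter> fst e)" for y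
        using that by (simp add: overlap transition_def d_inv \<gamma>_def)
    qed
    fix q assume "q \<in> fst d' \<inter> fst e"
    then have q: "q \<in> S" "q \<in> fst e" "q \<in> fst c"
      using S by (auto simp: d' d_def)
    \<comment> \<open>Passing through the chart c reduces the immersion property in any chart e to
      that of \<phi>, since the Jacobian between charts of M is invertible.\<close>
    have jac: "jacobian d e q = jacobian c e q ** jacobian d c q"
      using q jac_c(2)[OF q(1)]
      by (intro jacobian_chain inj_d chart_inj open_overlap transition_differentiable c e) (auto simp: d_def)
    have "inj ((*v) (jacobian c e q))"
      using jacobian_inverse[OF c(1) e q(3,2)] matrix_left_invertible_injective by blast
    moreover have "inj ((*v) (jacobian d c q))"
    proof -
      have "\<psi> q \<in> ?B"
        using q(1) \<psi>S by blast
      then show ?thesis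
        unfolding jac_c(1)[OF q(1)] by (rule \<phi>(4))
    qed
    ultimately show "inj ((*v) (jacobian d' e q))"
      unfolding d' jac using inj_compose[of "(*v) (jacobian c e q)" "(*v) (jacobian d c q)"]
      by (simp add: o_def matrix_vector_mul_assoc)
  qed
  have "inclusion_image {d} A q = image_distribution A l q" if "q \<in> topspace N" for q
  proof -
    have q: "q \<in> S" "q \<in> fst c" using that topN S by auto
    then obtain y where y: "y \<in> ?B" "q = \<gamma> y" by (auto simp: S_def)
    have "range ((*v) (jacobian d c q)) = range ((*v) (L q c))"
      using jac_c(1)[OF q(1)] \<phi>(5)[OF y(1)] \<gamma>[OF y(1)] chart_L_apply[OF c(1) q(2)] by (simp add: y(2))
    then show ?thesis
      using inclusion_image_eq_iff[OF imm _ _ c(1) q(2), of d] q(1) by (simp add: d_def)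
  qed
  then have "integral_manifold N {d} M A (image_distribution A l)"
    using imm unfolding integral_manifold_def by blast
  then show "\<exists>N (B :: ('a, 's) chart set). p \<in> topspace N \<and> integral_manifold N B M A (image_distribution A l)"
    using pS topN by blast
qed

end

theorem theorem5p1:
  fixes M :: "'a topology" and A :: "('a, 'n::finite) chart set"
    and F :: "('a, 'n, real) tensor11"
    and \<alpha> \<beta> :: "'k::{real_normed_field,euclidean_space}" and K :: nat
  assumes "F_structure_manifold M A F \<alpha> \<beta> K CARD('r::finite)"
  defines "l \<equiv> proj_l F \<alpha> \<beta> K" and "m \<equiv> proj_m F \<alpha> \<beta> K"
  shows "(integrable_distribution TYPE('r) M A (image_distribution A l) \<longleftrightarrow>
            (\<forall>X Y. vector_field M A X \<longrightarrow> vector_field M A Y \<longrightarrow>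
               vanishes_on M
                 (nijenhuis A l (tapply l (ext_vfield X)) (tapply l (ext_vfield Y))))) \<and>
         (integrable_distribution TYPE('r) M A (image_distribution A l) \<longleftrightarrow>
            (\<forall>X Y. vector_field M A X \<longrightarrow> vector_field M A Y \<longrightarrow>
               vanishes_on M
                 (tapply m (lie_bracket A (tapply l (ext_vfield X)) (tapply l (ext_vfield Y))))))"
proof -
  interpret F_structure M A F \<alpha> \<beta> K "CARD('r)"
    using assms(1) by unfold_locales (simp_all add: F_structure_manifold_def)
  have "integrable_distribution TYPE('r) M A (image_distribution A l) \<longleftrightarrow>
      (\<forall>c\<in>A. \<forall>p\<in>fst c. derivative_symmetric c p)"
    unfolding l_def using integrable_imp_derivative_symmetric derivative_symmetric_imp_integrable[OF refl] by blast
  \<comment> \<open>The two tensors agree as functions, so both stated conditions reduce to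
    \<open>bracket_condition_iff\<close>.\<close>
  moreover have "nijenhuis A l (tapply l (ext_vfield X)) (tapply l (ext_vfield Y)) =
      tapply m (lie_bracket A (tapply l (ext_vfield X)) (tapply l (ext_vfield Y)))" for X Y
    unfolding l_def m_def by (intro ext nijenhuis_eq)
  ultimately show ?thesis
    using bracket_condition_iff unfolding l_def[symmetric] m_def[symmetric] by simp
qed

end
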